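(* For every integer $k \ge 0$ one has the equalities of $\mathbb{Q}$-vector subspaces of $\mathbb{R}$ \[ \mathcal{L}^{e}_{k} = \mathcal{A}^{e}_{k} \qquad\text{and}\qquad \mathcal{L}^{o}_{k} = \mathcal{A}^{o}_{k}, \] where these spaces are defined in the context below.
   Context: For an index $\mathbf{k}=(k_1,\dots,k_n)$ write $|\mathbf{k}|=k_1+\dots+k_n$ (weight) and ${\rm dep}(\mathbf{k})=n$ (depth); the empty index $\emptyset$ has weight and depth $0$. Let $\mathbf{1}_n=(1,\dots,1)$ ($n$ ones); for indices of equal length, sums/differences are componentwise and $\mathbf{k}\ge\mathbf{l}$ means $k_u\ge l_u$ for all $u$. Iterated log-tangent integrals: for $\sigma\in\mathbb{R}$, $\mathbf{k}\in\mathbb{Z}_{\ge1}^n$, $\mathbf{l}\in\mathbb{Z}_{\ge0}^n$ with $\mathbf{k}-\mathbf{1}_n\ge\mathbf{l}$, \[ \mathrm{Lt}_{\mathbf{k}}^{\mathbf{l}}(\sigma)=(-1)^n\int_{0<\theta_1<\cdots<\theta_n<\sigma}\prod_{u=1}^n \theta_u^{l_u}\Big(\log\Big|\tan\frac{\theta_u}{2}\Big|\Big)^{k_u-1-l_u}\,d\theta_1\cdots d\theta_n, \] with $\mathrm{Lt}_{\emptyset}^{\emptyset}(\sigma)=1$. Define $\mathcal{L}^e_k$ (resp. $\mathcal{L}^o_k$) as the $\mathbb{Q}$-span of all $\mathrm{Lt}_{\mathbf{k}}^{\mathbf{l}}(\pi/2)$ over all $n\ge0$ and all pairs $\mathbf{k}\in\mathbb{Z}_{\ge1}^n$,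 $\mathbf{l}\in\mathbb{Z}_{\ge0}^n$ with $|\mathbf{k}|=k$, $\mathbf{k}-\mathbf{1}_n\ge\mathbf{l}$ and $|\mathbf{k}-\mathbf{1}_n-\mathbf{l}|$ even (resp. odd); the pair $(\emptyset,\emptyset)$ counts as even. Multiple $A$-functions: for $\mathbf{k}\in\mathbb{Z}_{\ge1}^n$ and $|z|<1$, \[ A(\mathbf{k};z)=2^n\sum_{\substack{0<m_1<\cdots<m_n\\ m_j\equiv j \bmod 2}}\frac{z^{m_n}}{m_1^{k_1}\cdots m_n^{k_n}}, \] continued holomorphically to $\mathbb{C}\setminus((-\infty,-1]\cup[1,\infty))$ (in particular defined at $z=i$), with $A(\emptyset;z)=1$. Set $A^e(\mathbf{k};\sigma)=\Re A(\mathbf{k};e^{i\sigma})$ if $|\mathbf{k}|$ is even and $=\Im A(\mathbf{k};e^{i\sigma})$ if $|\mathbf{k}|$ is odd; $A^o(\mathbf{k};\sigma)=\Im A(\mathbf{k};e^{i\sigma})$ if $|\mathbf{k}|$ is even and $=\Re A(\mathbf{k};e^{i\sigma})$ if $|\mathbf{k}|$ is odd. Define $\mathcal{A}^e_k$ (resp. $\mathcal{A}^o_k$) as the $\mathbb{Q}$-span of $A^e(\mathbf{k};\pi/2)$ (resp. $A^o(\mathbf{k};\pi/2)$) over all indices $\mathbf{k}\in\mathbb{Z}_{\ge1}^n$, $n\ge0$, with $|\mathbf{k}|=k$. *)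

theory Defs
  imports "HOL-Complex_Analysis.Complex_Analysis"
begin

text \<open>
  Indices are lists of natural numbers, with entries numbered from 0: the entry written
  \<open>k\<^sub>u\<close> with \<open>1 \<le> u \<le> n\<close> is \<open>ks ! (u - 1)\<close>.
\<close>

definition is_index :: "nat list \<Rightarrow> bool"
  where "is_index ks \<longleftrightarrow> (\<forall>k\<in>set ks. k \<ge> 1)"

definition weight :: "nat list \<Rightarrow> nat"
  where "weight ks = sum_list ks"

definition index_pair :: "nat list \<Rightarrow> nat list \<Rightarrow> bool"
  where "index_pair ks ls \<longleftrightarrow>
    is_index ks \<and> length ls = length ks \<and> (\<forall>u<length ks. ls ! u \<le> ks ! u - 1)"

text \<open>The exponents of the logarithms. For an \<open>index_pair\<close> the subtractions are never truncated.\<close>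

definition log_exp :: "nat list \<Rightarrow> nat list \<Rightarrow> nat \<Rightarrow> nat"
  where "log_exp ks ls u = ks ! u - 1 - ls ! u"

definition log_weight :: "nat list \<Rightarrow> nat list \<Rightarrow> nat"
  where "log_weight ks ls = (\<Sum>u<length ks. log_exp ks ls u)"

definition ordered_simplex :: "nat \<Rightarrow> real \<Rightarrow> (nat \<Rightarrow> real) set"
  where "ordered_simplex n \<sigma> =
    {\<theta>. (\<forall>u<n. 0 < \<theta> u \<and> \<theta> u < \<sigma>) \<and> strict_mono_on {..<n} \<theta>}"

text \<open>
  The integral is taken over \<open>n\<close>-dimensional Lebesgue measure, realised as a product
  measure. For \<open>n = 0\<close> this is the unit point mass, so \<open>Lt [] [] \<sigma> = 1\<close>
  (lemma \<open>Lt_Nil\<close> below).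
\<close>

definition Lt :: "nat list \<Rightarrow> nat list \<Rightarrow> real \<Rightarrow> real"
  where "Lt ks ls \<sigma> = (- 1) ^ length ks *
    (LINT \<theta>:ordered_simplex (length ks) \<sigma>|PiM {..<length ks} (\<lambda>_. lborel).
      (\<Prod>u<length ks. \<theta> u ^ (ls ! u) * ln \<bar>tan (\<theta> u / 2)\<bar> ^ log_exp ks ls u))"

lemma Lt_Nil: "Lt [] [] \<sigma> = 1"
  by (simp add: Lt_def set_lebesgue_integral_def ordered_simplex_def PiM_empty
      lebesgue_integral_count_space_finite)

text \<open>Tuples \<open>0 < m\<^sub>1 < \<dots> < m\<^sub>n\<close> with \<open>m\<^sub>j \<equiv> j mod 2\<close> for \<open>1 \<le> j \<le> n\<close>.\<close>

definition alt_tuples :: "nat \<Rightarrow> nat list set"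
  where "alt_tuples n = {ms. length ms = n \<and> sorted_wrt (<) ms \<and>
    (\<forall>j<n. 0 < ms ! j \<and> ms ! j mod 2 = (j + 1) mod 2)}"

definition A_series :: "nat list \<Rightarrow> complex \<Rightarrow> complex"
  where "A_series ks z = (if ks = [] then 1 else 2 ^ length ks *
    (\<Sum>\<^sub>\<infinity>ms\<in>alt_tuples (length ks).
      z ^ last ms / (\<Prod>j<length ks. of_nat (ms ! j) ^ (ks ! j))))"

definition A_domain :: "complex set"
  where "A_domain = - (complex_of_real ` ({..-1} \<union> {1..}))"

text \<open>
  The multiple \<open>A\<close>-function is the holomorphic continuation of its series from the
  unit disc to the doubly slit plane. Its values on \<open>A_domain\<close> do not depend on the
  choice made by \<open>SOME\<close>, see \<open>A_continuation_unique\<close>.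
\<close>

definition A_continuation :: "nat list \<Rightarrow> (complex \<Rightarrow> complex) \<Rightarrow> bool"
  where "A_continuation ks f \<longleftrightarrow>
    f holomorphic_on A_domain \<and> (\<forall>z. norm z < 1 \<longrightarrow> f z = A_series ks z)"

definition multA :: "nat list \<Rightarrow> complex \<Rightarrow> complex"
  where "multA ks = (SOME f. A_continuation ks f)"

lemma A_domain_iff: "z \<in> A_domain \<longleftrightarrow> (Im z = 0 \<longrightarrow> \<bar>Re z\<bar> < 1)"
  by (auto simp: A_domain_def image_iff complex_eq_iff)

lemma A_continuation_unique:
  assumes "A_continuation ks f" "A_continuation ks g" "z \<in> A_domain"
  shows "f z = g z"
proof (rule analytic_continuation_open[of "ball 0 1" A_domain f g])
  have "closed (complex_of_real ` ({..-1} \<union> {1..}))"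
    by (intro closed_injective_linear_image) (auto simp: bounded_linear.linear bounded_linear_of_real inj_on_def)
  then show "open A_domain"
    by (simp add: A_domain_def open_Compl)
  have "starlike A_domain"
    unfolding starlike_def
  proof (intro bexI[of _ 0] ballI subsetI)
    fix x y assume x: "x \<in> A_domain" and "y \<in> closed_segment 0 x"
    then obtain u where u: "0 \<le> u" "u \<le> 1" "y = u *\<^sub>R x"
      by (auto simp: closed_segment_def)
    have "\<bar>u\<bar> * \<bar>Re x\<bar> < 1" if "\<bar>Re x\<bar> < 1"
      using that u mult_left_le_one_le[of "\<bar>Re x\<bar>" u] by auto
    then show "y \<in> A_domain"
      using x u by (auto simp: A_domain_iff abs_mult)
  qed (simp add: A_domain_iff)
  then show "connected A_domain"
    by (rule starlike_imp_connected)
  show "ball 0 1 \<subseteq> A_domain"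
    using abs_Re_le_cmod by (force simp: A_domain_iff intro: le_less_trans)
qed (use assms in \<open>auto simp: A_continuation_def\<close>)

definition Ae :: "nat list \<Rightarrow> real \<Rightarrow> real"
  where "Ae ks \<sigma> = (if even (weight ks) then Re (multA ks (cis \<sigma>)) else Im (multA ks (cis \<sigma>)))"

definition Ao :: "nat list \<Rightarrow> real \<Rightarrow> real"
  where "Ao ks \<sigma> = (if even (weight ks) then Im (multA ks (cis \<sigma>)) else Re (multA ks (cis \<sigma>)))"

text \<open>The real numbers as a vector space over the rationals.\<close>

global_interpretation rat_real: vector_space "\<lambda>(q::rat) (x::real). of_rat q * x"
  defines rat_span = rat_real.span
  by unfold_locales (simp_all add: of_rat_add of_rat_mult algebra_simps)

definition L_e :: "nat \<Rightarrow> real set"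
  where "L_e k = rat_span
    {Lt ks ls (pi / 2) | ks ls. index_pair ks ls \<and> weight ks = k \<and> even (log_weight ks ls)}"

definition L_o :: "nat \<Rightarrow> real set"
  where "L_o k = rat_span
    {Lt ks ls (pi / 2) | ks ls. index_pair ks ls \<and> weight ks = k \<and> odd (log_weight ks ls)}"

definition A_e :: "nat \<Rightarrow> real set"
  where "A_e k = rat_span {Ae ks (pi / 2) | ks. is_index ks \<and> weight ks = k}"

definition A_o :: "nat \<Rightarrow> real set"
  where "A_o k = rat_span {Ao ks (pi / 2) | ks. is_index ks \<and> weight ks = k}"

end

theory Submission
  imports Defs "HOL-Real_Asymp.Real_Asymp"
begin

text \<open>
  On the disc, \<open>A(k\<^sub>1, \<dots>, k\<^sub>n; z)\<close> is the iterated integral from \<open>0\<close> to \<open>z\<close> of one form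
  \<open>2 dz / (1 - z\<^sup>2)\<close> followed by \<open>k\<^sub>j - 1\<close> forms \<open>dz / z\<close> for each \<open>j\<close>. Integrating along the
  segment from \<open>0\<close> to \<open>\<i>\<close> with \<open>z = \<i> tan (x / 2)\<close>, \<open>0 < x < \<pi> / 2\<close>, turns these forms into \<open>\<i> dx\<close>
  and \<open>d log tan (x / 2) = dx / sin x\<close>. Hence \<open>A(\<^bold>k; \<i>) = \<i>\<^sup>n A_real(\<pi> / 2)\<close> with a real iterated
  integral \<open>A_real\<close>, and the real or imaginary part in the definition of \<open>A\<^sup>e\<close> and \<open>A\<^sup>o\<close>
  vanishes or is \<open>\<plusminus> A_real\<close> according to the parity of weight plus depth.

  It remains to compare two families of functions on \<open>(0, \<pi>)\<close>. Integration by parts shows that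
  the rational combinations of the functions \<open>log\<^sup>b tan (x / 2) A_real(\<^bold>k; x)\<close> are closed under
  multiplication by \<open>x\<close> and by \<open>log tan (x / 2)\<close> and under integration from \<open>0\<close>, so they contain
  all iterated log-tangent integrals. Conversely, combinations of \<open>log\<^sup>b tan (x / 2)\<close> times iterated
  log-tangent integrals without powers of \<open>\<theta>\<close> are closed under integration against \<open>dx\<close> and
  \<open>dx / sin x\<close>, so they contain all \<open>A_real\<close>. At \<open>x = \<pi> / 2\<close> the logarithm vanishes, and all these
  operations respect weight and depth.
\<close>

subsection \<open>Multiple A-functions\<close>

lemma last_ge_of_sorted_wrt_less:
  fixes ms :: "nat list"
  assumes "sorted_wrt (<) ms" "x \<in> set ms"
  shows "x \<le> last (0 # ms)"
  using assms by (induction ms rule: rev_induct) (auto simp: sorted_wrt_append)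

text \<open>Prepending 0 assigns the empty tuple the last entry 0, so that depth 0 contributes
  exactly the constant term of \<open>A_series [] z = 1\<close>.\<close>

definition alt_tuples_to :: "nat \<Rightarrow> nat \<Rightarrow> nat list set"
  where "alt_tuples_to n m = {ms \<in> alt_tuples n. last (0 # ms) = m}"

lemma alt_tuples_to_subset: "alt_tuples_to n m \<subseteq> {ms. set ms \<subseteq> {..m} \<and> length ms = n}"
  unfolding alt_tuples_to_def alt_tuples_def
  using last_ge_of_sorted_wrt_less by blast

lemma finite_alt_tuples_to [simp]: "finite (alt_tuples_to n m)"
  by (rule finite_subset[OF alt_tuples_to_subset]) (simp add: finite_lists_length_eq)

text \<open>A crude bound, polynomial in \<open>m\<close>, suffices: it is only played against the
  geometric decay of \<open>norm z ^ m\<close>.\<close>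

lemma card_alt_tuples_to: "card (alt_tuples_to n m) \<le> Suc m ^ n"
proof -
  have "card (alt_tuples_to n m) \<le> card {ms. set ms \<subseteq> {..m} \<and> length ms = n}"
    by (intro card_mono alt_tuples_to_subset finite_lists_length_eq) auto
  then show ?thesis
    by (simp add: card_lists_length_eq)
qed

lemma snoc_in_alt_tuples:
  "ms @ [m] \<in> alt_tuples (Suc n) \<longleftrightarrow>
    ms \<in> alt_tuples n \<and> last (0 # ms) < m \<and> m mod 2 = Suc n mod 2"
  (is "?L \<longleftrightarrow> ?R")
proof
  assume ?L
  then have len: "length ms = n" and s: "sorted_wrt (<) ms" "\<forall>x\<in>set ms. x < m"
    and p: "\<And>j. j < Suc n \<Longrightarrow> 0 < (ms @ [m]) ! j \<and> (ms @ [m]) ! j mod 2 = (j + 1) mod 2"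
    by (auto simp: alt_tuples_def sorted_wrt_append)
  have "0 < ms ! j \<and> ms ! j mod 2 = (j + 1) mod 2" if "j < n" for j
    using p[of j] that len by (simp add: nth_append)
  moreover have "0 < m" "m mod 2 = Suc n mod 2"
    using p[of n] len by (simp_all add: nth_append)
  ultimately show ?R
    using len s by (auto simp: alt_tuples_def)
next
  assume R: ?R
  then have len: "length ms = n"
    by (simp add: alt_tuples_def)
  have "\<forall>x\<in>set ms. x < m"
    using R last_ge_of_sorted_wrt_less[of ms] by (fastforce simp: alt_tuples_def)
  moreover have "0 < m"
    using R by simp
  ultimately show ?L
    using R len by (auto simp: alt_tuples_def sorted_wrt_append nth_append less_Suc_eq)
qed

lemma alt_tuples_to_Suc:
  "alt_tuples_to (Suc n) m =
    (if m mod 2 = Suc n mod 2 then (\<lambda>ms. ms @ [m]) ` (\<Union>j<m. alt_tuples_to n j) else {})"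
proof -
  have "ms \<in> alt_tuples_to (Suc n) m \<longleftrightarrow>
      (\<exists>ms'. ms = ms' @ [m] \<and> ms' \<in> alt_tuples n \<and> last (0 # ms') < m \<and> m mod 2 = Suc n mod 2)" for ms
  proof (cases ms rule: rev_cases)
    case Nil
    then show ?thesis by (auto simp: alt_tuples_to_def alt_tuples_def)
  next
    case (snoc ms' m')
    then show ?thesis
      using snoc_in_alt_tuples[of ms' m' n] by (auto simp: alt_tuples_to_def)
  qed
  then show ?thesis
    by (auto simp: alt_tuples_to_def)
qed

definition A_denom :: "nat list \<Rightarrow> nat list \<Rightarrow> complex"
  where "A_denom ks ms = (\<Prod>j<length ks. of_nat (ms ! j) ^ (ks ! j))"

definition A_coeff :: "nat list \<Rightarrow> nat \<Rightarrow> complex"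
  where "A_coeff ks m = 2 ^ length ks * (\<Sum>ms\<in>alt_tuples_to (length ks) m. 1 / A_denom ks ms)"

lemma A_coeff_Nil: "A_coeff [] m = (if m = 0 then 1 else 0)"
proof -
  have "alt_tuples_to 0 m = (if m = 0 then {[]} else {})"
    by (auto simp: alt_tuples_to_def alt_tuples_def)
  then show ?thesis
    by (simp add: A_coeff_def A_denom_def)
qed

text \<open>Removing the largest entry \<open>m\<close> leaves a tuple whose last entry is any
  \<open>j < m\<close>, whence the partial sum. For \<open>m = 0\<close> that sum is empty, so the
  division by 0 is harmless.\<close>

lemma A_coeff_snoc:
  "A_coeff (ks @ [k]) m =
    (if m mod 2 = Suc (length ks) mod 2 then 2 / of_nat m ^ k * (\<Sum>j<m. A_coeff ks j) else 0)"
proof (cases "m mod 2 = Suc (length ks) mod 2")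
  case True
  let ?n = "length ks"
  have den: "A_denom (ks @ [k]) (ms @ [m]) = A_denom ks ms * of_nat m ^ k"
    if "ms \<in> alt_tuples_to ?n j" for ms j
    using that by (auto simp: A_denom_def alt_tuples_to_def alt_tuples_def nth_append)
  have "(\<Sum>ms\<in>alt_tuples_to (length (ks @ [k])) m. 1 / A_denom (ks @ [k]) ms) =
      (\<Sum>ms\<in>(\<Union>j<m. alt_tuples_to ?n j). 1 / A_denom (ks @ [k]) (ms @ [m]))"
    using True by (simp add: alt_tuples_to_Suc sum.reindex inj_on_def)
  also have "\<dots> = (\<Sum>j<m. \<Sum>ms\<in>alt_tuples_to ?n j. 1 / A_denom (ks @ [k]) (ms @ [m]))"
    proof (rule sum.UNION_disjoint)
    show "\<forall>i\<in>{..<m}. \<forall>j\<in>{..<m}. i \<noteq> j \<longrightarrow> alt_tuples_to ?n i \<inter> alt_tuples_to ?n j = {}"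
      by (auto simp: alt_tuples_to_def)
  qed auto
  also have "\<dots> = (\<Sum>j<m. \<Sum>ms\<in>alt_tuples_to ?n j. 1 / A_denom ks ms * (1 / of_nat m ^ k))"
    by (intro sum.cong refl) (simp add: den)
  also have "\<dots> = (\<Sum>j<m. \<Sum>ms\<in>alt_tuples_to ?n j. 1 / A_denom ks ms) * (1 / of_nat m ^ k)"
    by (simp only: sum_distrib_right)
  finally show ?thesis
    using True by (simp add: A_coeff_def sum_distrib_left mult_ac)
next
  case False
  then show ?thesis
    by (simp add: A_coeff_def alt_tuples_to_Suc)
qed

lemma A_coeff_parity: "A_coeff ks m = 0" if "m mod 2 \<noteq> length ks mod 2"
  using that by (cases ks rule: rev_cases) (auto simp: A_coeff_Nil A_coeff_snoc)

lemma summable_poly_power: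
  fixes r :: real
  assumes "0 \<le> r" "r < 1"
  shows "summable (\<lambda>m. real (Suc m) ^ n * r ^ m)"
proof (cases "r = 0")
  case True
  have "summable (\<lambda>m. real (Suc m) ^ n * 0 ^ m)"
    by (rule summable_finite[of "{0}"]) auto
  with True show ?thesis by simp
next
  case False
  \<comment> \<open>With \<open>r = s * s\<close>, one factor \<open>s ^ m\<close> absorbs the
    polynomial and the other remains as a summable geometric majorant.\<close>
  define s where "s = sqrt r"
  have s: "0 < s" "s < 1" "r = s * s"
    using assms False by (auto simp: s_def real_sqrt_lt_1_iff)
  show ?thesis
  proof (rule summable_comparison_test_bigo)
    show "summable (\<lambda>m. norm (s ^ m))"
      using s by (simp add: summable_geometric)
    have "(\<lambda>m. real (Suc m) ^ n * s ^ m) \<in> O(\<lambda>_. 1)"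
      using s by real_asymp
    then have "(\<lambda>m. (real (Suc m) ^ n * s ^ m) * s ^ m) \<in> O(\<lambda>m. 1 * s ^ m)"
      by (intro landau_o.big.mult) auto
    then show "(\<lambda>m. real (Suc m) ^ n * r ^ m) \<in> O(\<lambda>m. s ^ m)"
      by (simp add: s(3) power_mult_distrib mult_ac)
  qed
qed

text \<open>The tuples are grouped by their last entry, which is the exponent of \<open>z\<close>.
  Absolute summability over all pairs of exponent and tuple permits this rearrangement; each summand
  of \<open>A_coeff\<close> has norm at most 1 before the factor \<open>2 ^ n\<close>, since all
  entries are positive.\<close>

lemma A_coeff_sums:
  assumes "norm z < 1"
  shows "(\<lambda>m. A_coeff ks m * z ^ m) sums A_series ks z"
proof -
  let ?n = "length ks"
  let ?f = "\<lambda>(m, ms). z ^ m / A_denom ks ms"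
  have le1: "norm (1 / A_denom ks ms) \<le> 1" if "ms \<in> alt_tuples_to ?n m" for ms m
  proof -
    have "1 \<le> norm (A_denom ks ms)"
      unfolding A_denom_def prod_norm[symmetric] norm_power
      using that by (intro prod_ge_1)
        (auto simp: alt_tuples_to_def alt_tuples_def Suc_le_eq intro!: one_le_power)
    moreover from this have "0 < norm (A_denom ks ms)" by linarith
    ultimately show ?thesis by (simp add: norm_divide divide_le_eq_1)
  qed
  have abs: "(\<lambda>x. norm (?f x)) summable_on Sigma UNIV (alt_tuples_to ?n)"
    unfolding Infinite_Sum.abs_summable_on_Sigma_iff
  proof (intro conjI ballI)
    show "(\<lambda>ms. norm (?f (m, ms))) summable_on alt_tuples_to ?n m" for m
      by (simp add: summable_on_finite)
    have "(\<lambda>m. norm (real (Suc m) ^ ?n * norm z ^ m)) summable_on UNIV"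
      using summable_poly_power[of "norm z" ?n] assms
      by (intro norm_summable_imp_summable_on) (auto simp: abs_mult simp del: of_nat_Suc)
    then show "(\<lambda>m. norm (infsum (\<lambda>ms. norm (?f (m, ms))) (alt_tuples_to ?n m))) summable_on UNIV"
    proof (rule Infinite_Sum.abs_summable_on_comparison_test)
      fix m :: nat
      have "(\<Sum>ms\<in>alt_tuples_to ?n m. norm (?f (m, ms))) \<le> (\<Sum>ms\<in>alt_tuples_to ?n m. norm z ^ m)"
      proof (rule sum_mono)
        fix ms assume "ms \<in> alt_tuples_to ?n m"
        from mult_left_mono[OF le1[OF this], of "norm z ^ m"]
        show "norm (?f (m, ms)) \<le> norm z ^ m"
          by (simp add: norm_divide norm_power)
      qed
      also have "\<dots> = real (card (alt_tuples_to ?n m)) * norm z ^ m"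
        by simp
      also have "\<dots> \<le> real (Suc m ^ ?n) * norm z ^ m"
        by (intro mult_right_mono of_nat_mono card_alt_tuples_to) auto
      finally show "norm (infsum (\<lambda>ms. norm (?f (m, ms))) (alt_tuples_to ?n m)) \<le>
          norm (real (Suc m) ^ ?n * norm z ^ m)"
        by (simp add: sum_nonneg abs_mult)
    qed
  qed
  \<comment> \<open>Every tuple lies in exactly one fibre, the one over its last entry.\<close>
  have bij: "bij_betw (\<lambda>ms. (last (0 # ms), ms)) (alt_tuples ?n) (Sigma UNIV (alt_tuples_to ?n))"
    by (auto simp: bij_betw_def inj_on_def alt_tuples_to_def)
  have inner: "infsum (\<lambda>ms. 2 ^ ?n * ?f (m, ms)) (alt_tuples_to ?n m) = A_coeff ks m * z ^ m" for m
    by (simp add: A_coeff_def sum_distrib_left sum_distrib_right)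
  have summ: "(\<lambda>x. 2 ^ ?n * ?f x) summable_on Sigma UNIV (alt_tuples_to ?n)"
    using abs_summable_summable[OF abs] by (rule summable_on_cmult_right)
  have "A_series ks z = 2 ^ ?n * (\<Sum>\<^sub>\<infinity>ms\<in>alt_tuples ?n. ?f (last (0 # ms), ms))"
  proof (cases "ks = []")
    case True
    have "alt_tuples 0 = {[]}" by (auto simp: alt_tuples_def)
    with True show ?thesis by (simp add: A_series_def A_denom_def)
  next
    case False
    have "(\<Sum>\<^sub>\<infinity>ms\<in>alt_tuples ?n. z ^ last ms / A_denom ks ms) =
        (\<Sum>\<^sub>\<infinity>ms\<in>alt_tuples ?n. z ^ last (0 # ms) / A_denom ks ms)"
      using False by (intro infsum_cong) (auto simp: alt_tuples_def)
    with False show ?thesis by (simp add: A_series_def A_denom_def)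
  qed
  also have "\<dots> = 2 ^ ?n * infsum ?f (Sigma UNIV (alt_tuples_to ?n))"
    using infsum_reindex_bij_betw[OF bij, of ?f] by simp
  also have "\<dots> = infsum (\<lambda>x. 2 ^ ?n * ?f x) (Sigma UNIV (alt_tuples_to ?n))"
    by (simp add: infsum_cmult_right')
  also have "\<dots> = infsum (\<lambda>m. infsum (\<lambda>ms. 2 ^ ?n * ?f (m, ms)) (alt_tuples_to ?n m)) UNIV"
    using infsum_Sigma_banach[OF summ] by simp
  finally have eq: "A_series ks z = infsum (\<lambda>m. A_coeff ks m * z ^ m) UNIV"
    by (simp only: inner)
  have "(\<lambda>m. infsum (\<lambda>ms. 2 ^ ?n * ?f (m, ms)) (alt_tuples_to ?n m)) summable_on UNIV"
    using summable_on_Sigma_banach[of "\<lambda>m ms. 2 ^ ?n * ?f (m, ms)" UNIV "alt_tuples_to ?n"] summ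
    by (simp add: case_prod_unfold)
  then have "((\<lambda>m. A_coeff ks m * z ^ m) has_sum A_series ks z) UNIV"
    unfolding inner eq by (rule has_sum_infsum)
  then show ?thesis by (rule has_sum_imp_sums)
qed

section \<open>Differential equations of the A-series in the unit disc\<close>

lemma A_series_has_field_derivative:
  assumes "norm z < 1"
  obtains D where "(A_series ks has_field_derivative D) (at z)"
    "(\<lambda>m. of_nat (Suc m) * A_coeff ks (Suc m) * z ^ m) sums D"
proof -
  have sm: "summable (\<lambda>m. A_coeff ks m * w ^ m)" if "norm w < 1" for w
    using A_coeff_sums[OF that] by (rule sums_summable)
  have "((\<lambda>w. \<Sum>m. A_coeff ks m * w ^ m) has_field_derivative (\<Sum>m. diffs (A_coeff ks) m * z ^ m)) (at z)"
    using sm assms by (rule termdiffs_strong'[where K = 1])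
  then have "(A_series ks has_field_derivative (\<Sum>m. diffs (A_coeff ks) m * z ^ m)) (at z)"
    by (rule has_field_derivative_transform_within_open[where S = "ball 0 1"])
      (use assms A_coeff_sums in \<open>auto simp: sums_iff\<close>)
  moreover have "summable (\<lambda>m. diffs (A_coeff ks) m * z ^ m)"
    using assms sm by (rule termdiff_converges[where K = 1])
  ultimately show ?thesis
    using that by (auto simp: diffs_def summable_sums)
qed

lemma A_series_0: "ks \<noteq> [] \<Longrightarrow> A_series ks 0 = 0"
proof -
  assume "ks \<noteq> []"
  then have "A_coeff ks 0 = 0"
    by (cases ks rule: rev_cases) (auto simp: A_coeff_snoc)
  moreover have "(\<lambda>m. A_coeff ks m * 0 ^ m) sums A_series ks 0"
    by (rule A_coeff_sums) simp
  moreover have "(\<lambda>m. A_coeff ks m * 0 ^ m) sums A_coeff ks 0"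
    using powser_sums_zero[of "A_coeff ks"] by simp
  ultimately show ?thesis
    using sums_unique2 by fastforce
qed

text \<open>Termwise, \<open>z d/dz\<close> multiplies the coefficient of \<open>z ^ m\<close> by
  \<open>m\<close> and so cancels one power of \<open>m\<close> in the denominator. The product form
  \<open>z * D\<close> includes the point 0.\<close>

lemma A_series_deriv_snoc_Suc:
  assumes "norm z < 1"
  obtains D where "(A_series (ks @ [Suc k]) has_field_derivative D) (at z)"
    "z * D = A_series (ks @ [k]) z"
proof -
  obtain D where D: "(A_series (ks @ [Suc k]) has_field_derivative D) (at z)"
    "(\<lambda>m. of_nat (Suc m) * A_coeff (ks @ [Suc k]) (Suc m) * z ^ m) sums D"
    using A_series_has_field_derivative[OF assms] .
  have "of_nat m * A_coeff (ks @ [Suc k]) m = A_coeff (ks @ [k]) m" for m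
    by (cases "m = 0") (auto simp: A_coeff_snoc field_simps)
  then have "(\<lambda>m. A_coeff (ks @ [k]) (Suc m) * z ^ m) sums D"
    using D(2) by (simp only:)
  then have "(\<lambda>m. z * (A_coeff (ks @ [k]) (Suc m) * z ^ m)) sums (z * D)"
    by (rule sums_mult)
  then have "(\<lambda>m. A_coeff (ks @ [k]) (Suc m) * z ^ Suc m) sums (z * D)"
    by (simp add: mult_ac)
  moreover have "A_coeff (ks @ [k]) 0 = 0"
    by (simp add: A_coeff_snoc)
  ultimately have "(\<lambda>m. A_coeff (ks @ [k]) m * z ^ m) sums (z * D)"
    using sums_Suc_iff[of "\<lambda>m. A_coeff (ks @ [k]) m * z ^ m"] by simp
  with A_coeff_sums[OF assms] have "z * D = A_series (ks @ [k]) z"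
    using sums_unique2 by blast
  with D(1) show ?thesis using that by blast
qed

text \<open>Multiplying the derivative by \<open>1 - z ^ 2\<close> takes differences of its
  coefficients two steps apart. These coefficients are partial sums, so the difference telescopes to
  two terms, one of which vanishes by parity.\<close>

lemma A_series_deriv_snoc_1:
  assumes "norm z < 1"
  shows "(A_series (ks @ [1]) has_field_derivative 2 / (1 - z\<^sup>2) * A_series ks z) (at z)"
proof -
  let ?d = "\<lambda>m. of_nat m * A_coeff (ks @ [1]) m"
  obtain D where D: "(A_series (ks @ [1]) has_field_derivative D) (at z)"
    "(\<lambda>m. ?d (Suc m) * z ^ m) sums D"
    using A_series_has_field_derivative[OF assms] .
  have d: "?d m = (if m mod 2 = Suc (length ks) mod 2 then 2 * (\<Sum>j<m. A_coeff ks j) else 0)" for m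
    by (cases "m = 0") (auto simp: A_coeff_snoc field_simps)
  \<comment> \<open>The coefficients of \<open>z ^ 2 * D\<close>: those of \<open>D\<close>, which
    are \<open>?d (Suc m)\<close>, shifted by two places.\<close>
  let ?e = "\<lambda>m. if m < 2 then 0 else ?d (m - 1)"
  have "(\<lambda>m. z\<^sup>2 * (?d (Suc m) * z ^ m)) sums (z\<^sup>2 * D)"
    using D(2) by (rule sums_mult)
  then have "(\<lambda>m. ?e (Suc (Suc m)) * z ^ Suc (Suc m)) sums (z\<^sup>2 * D)"
    by (simp add: mult_ac power2_eq_square)
  then have "(\<lambda>m. ?e m * z ^ m) sums (z\<^sup>2 * D)"
    by (subst (asm) sums_Suc_iff, subst (asm) sums_Suc_iff) simp
  with D(2) have "(\<lambda>m. ?d (Suc m) * z ^ m - ?e m * z ^ m) sums (D - z\<^sup>2 * D)"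
    by (rule sums_diff)
  \<comment> \<open>If \<open>m\<close> has the parity of the depth, the difference is twice the sum
    of the coefficients at \<open>m\<close> and \<open>m - 1\<close>, and the latter is 0. Otherwise
    both sides vanish. The cases \<open>m < 2\<close> have no shifted term.\<close>
  moreover have "?d (Suc m) - ?e m = 2 * A_coeff ks m" for m
  proof (cases "m < 2")
    case True
    then have "m = 0 \<or> m = 1" by auto
    then show ?thesis
      unfolding d using A_coeff_parity[of 0 ks] A_coeff_parity[of 1 ks]
      by (auto simp: mod_Suc split: if_splits)
  next
    case False
    then obtain j where "m = Suc (Suc j)"
      by (metis add_2_eq_Suc le_Suc_ex not_less)
    then show ?thesis
      unfolding d by (auto simp: A_coeff_parity mod_Suc)
  qed
  then have "?d (Suc m) * z ^ m - ?e m * z ^ m = 2 * (A_coeff ks m * z ^ m)" for m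
    by (metis (no_types, lifting) left_diff_distrib mult.assoc)
  ultimately have "(\<lambda>m. 2 * (A_coeff ks m * z ^ m)) sums (D - z\<^sup>2 * D)"
    by (simp only:)
  with sums_mult[OF A_coeff_sums[OF assms], of 2] have "D - z\<^sup>2 * D = 2 * A_series ks z"
    using sums_unique2 by blast
  moreover have "z\<^sup>2 \<noteq> 1"
    using assms by (auto simp: power2_eq_1_iff)
  ultimately have "D = 2 / (1 - z\<^sup>2) * A_series ks z"
    by (simp add: field_simps)
  with D(1) show ?thesis by simp
qed

section \<open>Holomorphic continuation to the slit plane\<close>

lemma open_A_domain: "open A_domain"
proof -
  have "closed (complex_of_real ` ({..-1} \<union> {1..}))"
    by (intro closed_injective_linear_image)
      (auto simp: bounded_linear.linear bounded_linear_of_real inj_on_def)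
  then show ?thesis
    by (simp add: A_domain_def open_Compl)
qed

lemma starlike_A_domain: "starlike A_domain"
  unfolding starlike_def
proof (intro bexI[of _ 0] ballI subsetI)
  fix x y assume x: "x \<in> A_domain" and "y \<in> closed_segment 0 x"
  then obtain u where u: "0 \<le> u" "u \<le> 1" "y = u *\<^sub>R x"
    by (auto simp: closed_segment_def)
  have "\<bar>u\<bar> * \<bar>Re x\<bar> < 1" if "\<bar>Re x\<bar> < 1"
    using that u mult_left_le_one_le[of "\<bar>Re x\<bar>" u] by auto
  then show "y \<in> A_domain"
    using x u by (auto simp: A_domain_iff abs_mult)
qed (simp add: A_domain_iff)

lemma in_A_domain_if_norm_less_1: "norm z < 1 \<Longrightarrow> z \<in> A_domain"
  using abs_Re_le_cmod[of z] by (simp add: A_domain_iff)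

lemma A_domain_square_neq_1: "z \<in> A_domain \<Longrightarrow> z\<^sup>2 \<noteq> 1"
  by (auto simp: power2_eq_1_iff A_domain_iff)

text \<open>The exceptional point \<open>0\<close> accounts for the removable singularity of \<open>dz / z\<close>.\<close>

lemma A_continuation_of_deriv:
  assumes "h holomorphic_on A_domain" "ks \<noteq> []"
    and deriv: "\<And>z. norm z < 1 \<Longrightarrow> z \<noteq> 0 \<Longrightarrow> (A_series ks has_field_derivative h z) (at z)"
  shows "\<exists>G. A_continuation ks G \<and> (\<forall>z\<in>A_domain. (G has_field_derivative h z) (at z))"
proof -
  have "\<exists>g. \<forall>x\<in>A_domain. (g has_field_derivative h x) (at x)"
    using assms(1) open_A_domain starlike_A_domain
    by (intro holomorphic_starlike_primitive[where k = "{}"])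
      (auto simp: holomorphic_on_imp_continuous_on holomorphic_on_imp_differentiable_at)
  then obtain g where g: "\<And>x. x \<in> A_domain \<Longrightarrow> (g has_field_derivative h x) (at x)"
    by blast
  \<comment> \<open>Normalised to vanish at 0, like the series of a nonempty index; this forces the
    constant \<open>c\<close> below to be 0.\<close>
  define G where "G = (\<lambda>z. g z - g 0)"
  have G: "(G has_field_derivative h x) (at x)" if "x \<in> A_domain" for x
    unfolding G_def using g[OF that] by (auto intro!: derivative_eq_intros)
  \<comment> \<open>The derivative of the series is prescribed only away from 0. Continuity on the
    whole disc lets the criterion for constancy ignore that single point.\<close>
  have "continuous_on (ball 0 1) (A_series ks)"
  proof (intro continuous_at_imp_continuous_on ballI)
    fix z :: complex assume "z \<in> ball 0 1"
    then have "norm z < 1" by simp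
    then show "isCont (A_series ks) z"
      by (rule A_series_has_field_derivative) (rule DERIV_isCont)
  qed
  moreover have "continuous_on (ball 0 1) G"
    by (intro continuous_at_imp_continuous_on ballI DERIV_isCont[OF G])
      (simp add: in_A_domain_if_norm_less_1)
  ultimately have "continuous_on (ball 0 1) (\<lambda>z. G z - A_series ks z)"
    by (intro continuous_intros)
  moreover have "((\<lambda>z. G z - A_series ks z) has_field_derivative 0) (at z)"
    if "z \<in> ball 0 1 - {0}" for z
    using that G[of z] deriv[of z] in_A_domain_if_norm_less_1[of z]
    by (auto intro!: derivative_eq_intros)
  ultimately obtain c where c: "\<And>z. z \<in> ball 0 1 \<Longrightarrow> G z - A_series ks z = c"
    using DERIV_zero_connected_constant[of "ball 0 1" "{0}" "\<lambda>z. G z - A_series ks z"]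
    by auto
  have "c = 0"
    using c[of 0] assms(2) by (simp add: G_def A_series_0)
  then have "G z = A_series ks z" if "norm z < 1" for z
    using c[of z] that by simp
  moreover have "G holomorphic_on A_domain"
    unfolding holomorphic_on_def
    using G field_differentiable_def field_differentiable_at_within by blast
  ultimately have "A_continuation ks G"
    by (simp add: A_continuation_def)
  then show ?thesis using G by blast
qed

lemma A_continuation_snoc_1:
  assumes "A_continuation ks f"
  shows "\<exists>G. A_continuation (ks @ [1]) G \<and>
    (\<forall>z\<in>A_domain. (G has_field_derivative 2 / (1 - z\<^sup>2) * f z) (at z))"
proof -
  have "(\<lambda>z. 2 / (1 - z\<^sup>2) * f z) holomorphic_on A_domain"
    using assms A_domain_square_neq_1
    by (intro holomorphic_intros) (auto simp: A_continuation_def)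
  moreover have "(A_series (ks @ [1]) has_field_derivative 2 / (1 - z\<^sup>2) * f z) (at z)"
    if "norm z < 1" for z
    using A_series_deriv_snoc_1[OF that] that assms by (simp add: A_continuation_def)
  ultimately show ?thesis
    by (intro A_continuation_of_deriv) simp_all
qed

lemma A_continuation_snoc_Suc:
  assumes "A_continuation (ks @ [k]) f"
  shows "\<exists>G. A_continuation (ks @ [Suc k]) G \<and>
    (\<forall>z\<in>A_domain. z \<noteq> 0 \<longrightarrow> (G has_field_derivative f z / z) (at z))"
proof -
  \<comment> \<open>The quotient \<open>f z / z\<close> with its removable singularity filled in;
    \<open>f 0 = 0\<close> because the index is nonempty.\<close>
  let ?h = "\<lambda>z. if z = 0 then deriv f 0 else (f z - f 0) / (z - 0)"
  have 0: "f 0 = 0"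
    using assms by (simp add: A_continuation_def A_series_0)
  have "?h holomorphic_on A_domain"
    using assms open_A_domain by (intro pole_lemma_open) (auto simp: A_continuation_def)
  moreover have "(A_series (ks @ [Suc k]) has_field_derivative ?h z) (at z)"
    if z: "norm z < 1" "z \<noteq> 0" for z
  proof -
    obtain D where "(A_series (ks @ [Suc k]) has_field_derivative D) (at z)"
      "z * D = A_series (ks @ [k]) z"
      using A_series_deriv_snoc_Suc[OF z(1)] .
    moreover from this have "D = ?h z"
      using z assms 0 by (auto simp: A_continuation_def field_simps)
    ultimately show ?thesis by simp
  qed
  ultimately have "\<exists>G. A_continuation (ks @ [Suc k]) G \<and>
      (\<forall>z\<in>A_domain. (G has_field_derivative ?h z) (at z))"
    by (intro A_continuation_of_deriv) simp_all
  then obtain G where G: "A_continuation (ks @ [Suc k]) G"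
    "\<And>z. z \<in> A_domain \<Longrightarrow> (G has_field_derivative ?h z) (at z)"
    by blast
  have "(G has_field_derivative f z / z) (at z)" if "z \<in> A_domain" "z \<noteq> 0" for z
    using G(2)[OF that(1)] that(2) 0 by simp
  with G(1) show ?thesis by blast
qed

lemma A_continuation_Nil: "A_continuation [] (\<lambda>_. 1)"
  by (simp add: A_continuation_def A_series_def)

text \<open>The outer induction appends an entry, the inner one raises this last entry from 1. Each
  step integrates one of the two differential forms over the starlike slit plane.\<close>

lemma A_continuation_exists: "is_index ks \<Longrightarrow> \<exists>f. A_continuation ks f"
proof (induction ks rule: rev_induct)
  case Nil
  then show ?case using A_continuation_Nil by blast
next
  case (snoc k ks)
  then have "1 \<le> k" "is_index ks" by (auto simp: is_index_def)
  from this(1) show ?case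
  proof (induction k rule: dec_induct)
    case base
    obtain f where "A_continuation ks f"
      using snoc.IH[OF \<open>is_index ks\<close>] by blast
    then show ?case using A_continuation_snoc_1 by blast
  next
    case (step k)
    then obtain f where "A_continuation (ks @ [k]) f"
      by blast
    then show ?case using A_continuation_snoc_Suc by blast
  qed
qed

lemma A_continuation_multA: "is_index ks \<Longrightarrow> A_continuation ks (multA ks)"
  unfolding multA_def using A_continuation_exists by (rule someI_ex)

lemma multA_Nil: "z \<in> A_domain \<Longrightarrow> multA [] z = 1"
  using A_continuation_unique[OF A_continuation_multA A_continuation_Nil]
  by (simp add: is_index_def)

lemma multA_0: "is_index ks \<Longrightarrow> ks \<noteq> [] \<Longrightarrow> multA ks 0 = 0"
  using A_continuation_multA[of ks] by (simp add: A_continuation_def A_series_0)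

text \<open>\<open>multA\<close> is an arbitrary choice, but it agrees with the primitive
  \<open>G\<close> on the open slit plane and therefore shares its derivatives there.\<close>

lemma multA_deriv_transfer:
  assumes "is_index ks" "A_continuation ks G" "z \<in> A_domain" "(G has_field_derivative D) (at z)"
  shows "(multA ks has_field_derivative D) (at z)"
  using assms(4) open_A_domain assms(3)
proof (rule has_field_derivative_transform_within_open)
  show "G w = multA ks w" if "w \<in> A_domain" for w
    using A_continuation_unique[OF assms(2) A_continuation_multA[OF assms(1)] that] .
qed

lemma multA_deriv_snoc_1:
  assumes "is_index ks" "z \<in> A_domain"
  shows "(multA (ks @ [1]) has_field_derivative 2 / (1 - z\<^sup>2) * multA ks z) (at z)"
proof -
  obtain G where "A_continuation (ks @ [1]) G"
    "(G has_field_derivative 2 / (1 - z\<^sup>2) * multA ks z) (at z)"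
    using A_continuation_snoc_1[OF A_continuation_multA[OF assms(1)]] assms(2) by blast
  moreover have "is_index (ks @ [1])"
    using assms(1) by (auto simp: is_index_def)
  ultimately show ?thesis
    using assms(2) by (intro multA_deriv_transfer)
qed

lemma multA_deriv_snoc_Suc:
  assumes "is_index (ks @ [k])" "z \<in> A_domain" "z \<noteq> 0"
  shows "(multA (ks @ [Suc k]) has_field_derivative multA (ks @ [k]) z / z) (at z)"
proof -
  obtain G where "A_continuation (ks @ [Suc k]) G"
    "(G has_field_derivative multA (ks @ [k]) z / z) (at z)"
    using A_continuation_snoc_Suc[OF A_continuation_multA[OF assms(1)]] assms(2,3) by blast
  moreover have "is_index (ks @ [Suc k])"
    using assms(1) by (auto simp: is_index_def)
  ultimately show ?thesis
    using assms(2) by (intro multA_deriv_transfer)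
qed

subsection \<open>Restriction to the imaginary axis\<close>

text \<open>The path runs up the imaginary axis and reaches the point \<open>\<i>\<close> at
  \<open>x = pi / 2\<close>. Each entry of the index contributes one form that becomes
  \<open>\<i> dx\<close>, so dividing by the power of \<open>\<i>\<close> leaves a real function,
  see \<open>Im_A_arc\<close>.\<close>

definition A_arc :: "nat list \<Rightarrow> real \<Rightarrow> complex"
  where "A_arc ks x = multA ks (\<i> * of_real (tan (x / 2))) / \<i> ^ length ks"

definition A_real :: "nat list \<Rightarrow> real \<Rightarrow> real"
  where "A_real ks x = Re (A_arc ks x)"

lemma imaginary_in_A_domain: "\<i> * of_real t \<in> A_domain"
  by (simp add: A_domain_iff)

lemma cos_half_pos: "- pi < x \<Longrightarrow> x < pi \<Longrightarrow> 0 < cos (x / 2)"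
  by (rule cos_gt_zero_pi) auto

lemma tan_half_pos: "0 < x \<Longrightarrow> x < pi \<Longrightarrow> 0 < tan (x / 2)"
  by (rule tan_gt_zero) auto

lemma A_arc_deriv:
  assumes "- pi < x" "x < pi"
    and "(multA ks has_field_derivative D) (at (\<i> * of_real (tan (x / 2))))"
  shows "(A_arc ks has_vector_derivative
      \<i> * of_real ((1 + (tan (x / 2))\<^sup>2) / 2) * D / \<i> ^ length ks) (at x)"
proof -
  have c: "cos (x / 2) \<noteq> 0"
    using cos_half_pos assms by fastforce
  have "((\<lambda>x. tan (x / 2)) has_real_derivative (1 + (tan (x / 2))\<^sup>2) / 2) (at x)"
    using c by (auto intro!: derivative_eq_intros simp: tan_sec inverse_eq_divide power_divide)
  then have "((\<lambda>x. \<i> * of_real (tan (x / 2))) has_vector_derivative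
      \<i> * of_real ((1 + (tan (x / 2))\<^sup>2) / 2)) (at x)"
    by (intro has_vector_derivative_mult_right has_vector_derivative_of_real)
      (simp add: has_real_derivative_iff_has_vector_derivative)
  from field_vector_diff_chain_at[OF this assms(3)]
  have "((\<lambda>x. multA ks (\<i> * of_real (tan (x / 2)))) has_vector_derivative
      \<i> * of_real ((1 + (tan (x / 2))\<^sup>2) / 2) * D) (at x)"
    by (simp add: o_def)
  then show ?thesis
    unfolding A_arc_def by (rule has_vector_derivative_divide)
qed

lemma one_plus_square_neq_0: "1 + (complex_of_real t)\<^sup>2 \<noteq> 0"
proof -
  have "1 + t\<^sup>2 \<noteq> 0" by (smt (verit) zero_le_power2)
  then have "complex_of_real (1 + t\<^sup>2) \<noteq> 0" by (metis of_real_eq_0_iff)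
  then show ?thesis by simp
qed

lemma A_arc_deriv_snoc_1:
  assumes "is_index ks" "- pi < x" "x < pi"
  shows "(A_arc (ks @ [1]) has_vector_derivative A_arc ks x) (at x)"
proof -
  let ?t = "tan (x / 2)"
  have "(A_arc (ks @ [1]) has_vector_derivative
      \<i> * of_real ((1 + ?t\<^sup>2) / 2) * (2 / (1 - (\<i> * of_real ?t)\<^sup>2) * multA ks (\<i> * of_real ?t)) /
        \<i> ^ length (ks @ [1])) (at x)"
    using assms(2,3) multA_deriv_snoc_1[OF assms(1) imaginary_in_A_domain] by (rule A_arc_deriv)
  also have "\<i> * of_real ((1 + ?t\<^sup>2) / 2) * (2 / (1 - (\<i> * of_real ?t)\<^sup>2) * multA ks (\<i> * of_real ?t)) /
        \<i> ^ length (ks @ [1]) = A_arc ks x"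
  proof -
    have "\<i> * (u / 2) * (2 / u * a) / (w * \<i>) = a / w" if "u \<noteq> 0" for a u w :: complex
      using that by simp
    note * = this[OF one_plus_square_neq_0[of ?t], of "multA ks (\<i> * of_real ?t)" "\<i> ^ length ks"]
    have "1 - (\<i> * of_real ?t)\<^sup>2 = 1 + (complex_of_real ?t)\<^sup>2"
      "complex_of_real ((1 + ?t\<^sup>2) / 2) = (1 + (of_real ?t)\<^sup>2) / 2"
      by (simp_all add: power_mult_distrib)
    moreover have "\<i> ^ length (ks @ [1]) = \<i> ^ length ks * \<i>"
      by simp
    ultimately show ?thesis
      by (simp only: * A_arc_def)
  qed
  finally show ?thesis .
qed

lemma A_arc_deriv_snoc_Suc:
  assumes "is_index (ks @ [k])" "0 < x" "x < pi"
  shows "(A_arc (ks @ [Suc k]) has_vector_derivative A_arc (ks @ [k]) x / of_real (sin x)) (at x)"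
proof -
  let ?t = "tan (x / 2)"
  have t: "?t > 0"
    using tan_half_pos assms by simp
  \<comment> \<open>The half-angle formula identifies the pulled-back form,
    \<open>(1 + t ^ 2) / (2 * t)\<close> with \<open>t = tan (x / 2)\<close>, as
    \<open>1 / sin x\<close>.\<close>
  have sin: "sin x = 2 * ?t / (1 + ?t\<^sup>2)"
    using sin_tan_half[of "x / 2"] by simp
  have "(A_arc (ks @ [Suc k]) has_vector_derivative
      \<i> * of_real ((1 + ?t\<^sup>2) / 2) * (multA (ks @ [k]) (\<i> * of_real ?t) / (\<i> * of_real ?t)) /
        \<i> ^ length (ks @ [Suc k])) (at x)"
    using assms t by (intro A_arc_deriv multA_deriv_snoc_Suc imaginary_in_A_domain) auto
  also have "\<i> * of_real ((1 + ?t\<^sup>2) / 2) * (multA (ks @ [k]) (\<i> * of_real ?t) / (\<i> * of_real ?t)) /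
        \<i> ^ length (ks @ [Suc k]) = A_arc (ks @ [k]) x / of_real (sin x)"
  proof -
    have "\<i> * (u / 2) * (a / (\<i> * v)) / w = a / w / (2 * v / u)" for a u v w :: complex
      by (simp add: mult_ac)
    from this[of "1 + (of_real ?t)\<^sup>2" _ "of_real ?t"] show ?thesis
      unfolding sin by (simp add: A_arc_def)
  qed
  finally show ?thesis .
qed

lemma A_arc_0: "is_index ks \<Longrightarrow> ks \<noteq> [] \<Longrightarrow> A_arc ks 0 = 0"
  by (simp add: A_arc_def multA_0)

text \<open>The rule for \<open>dx / sin x\<close> breaks down at 0. Holomorphy of
  \<open>multA\<close> at 0 supplies differentiability at this endpoint.\<close>

lemma A_arc_differentiable_0:
  assumes "is_index ks"
  obtains D where "(A_arc ks has_vector_derivative D) (at 0)"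
proof -
  have "multA ks holomorphic_on A_domain"
    using A_continuation_multA[OF assms] by (simp add: A_continuation_def)
  then have "multA ks field_differentiable (at 0)"
    using open_A_domain by (rule holomorphic_on_imp_differentiable_at) (simp add: A_domain_iff)
  then show ?thesis
    using A_arc_deriv[of 0 ks] that by (auto simp: field_differentiable_def)
qed

lemma A_real_Nil: "A_real [] x = 1"
  by (simp add: A_real_def A_arc_def multA_Nil imaginary_in_A_domain)

lemma A_real_deriv_snoc_1:
  assumes "is_index ks" "- pi < x" "x < pi"
  shows "(A_real (ks @ [1]) has_real_derivative A_real ks x) (at x)"
  using bounded_linear.has_vector_derivative[OF bounded_linear_Re A_arc_deriv_snoc_1[OF assms]]
  by (simp add: A_real_def[abs_def] has_real_derivative_iff_has_vector_derivative)

lemma A_real_deriv_snoc_Suc: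
  assumes "is_index (ks @ [k])" "0 < x" "x < pi"
  shows "(A_real (ks @ [Suc k]) has_real_derivative A_real (ks @ [k]) x / sin x) (at x)"
  using bounded_linear.has_vector_derivative[OF bounded_linear_Re A_arc_deriv_snoc_Suc[OF assms]]
  by (simp add: A_real_def[abs_def] has_real_derivative_iff_has_vector_derivative)

text \<open>\<open>A_real\<close> is differentiable at 0 with value 0, so the quotient is a
  convergent difference quotient. This linear vanishing later beats every power of the
  logarithm.\<close>

lemma A_real_div_tendsto:
  assumes "is_index ks" "ks \<noteq> []"
  obtains D where "((\<lambda>x. A_real ks x / x) \<longlongrightarrow> D) (at_right 0)"
proof -
  obtain D where "(A_arc ks has_vector_derivative D) (at 0)"
    using A_arc_differentiable_0[OF assms(1)] .
  from bounded_linear.has_vector_derivative[OF bounded_linear_Re this]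
  have "(A_real ks has_real_derivative Re D) (at 0)"
    by (simp add: A_real_def[abs_def] has_real_derivative_iff_has_vector_derivative)
  then have "((\<lambda>x. A_real ks x / x) \<longlongrightarrow> Re D) (at 0)"
    using A_arc_0[OF assms] by (simp add: has_field_derivative_iff A_real_def)
  then have "((\<lambda>x. A_real ks x / x) \<longlongrightarrow> Re D) (at_right 0)"
    by (rule tendsto_within_subset) simp
  then show ?thesis using that by blast
qed

text \<open>For a nonempty index the function vanishes at 0 and, by induction, has real derivative
  on \<open>(0, pi)\<close>, so its imaginary part stays 0.\<close>

lemma Im_A_arc:
  assumes "is_index ks" "0 \<le> x" "x < pi"
  shows "Im (A_arc ks x) = 0"
  using assms
proof (induction ks arbitrary: x rule: rev_induct)
  case Nil
  then show ?case
    by (simp add: A_arc_def multA_Nil imaginary_in_A_domain)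
next
  case (snoc k ks)
  have zero: "Im (A_arc ls x) = 0"
    if ls: "is_index ls" "ls \<noteq> []" and x: "0 \<le> x" "x < pi"
      and d: "\<And>y. 0 < y \<Longrightarrow> y < pi \<Longrightarrow> \<exists>D. (A_arc ls has_vector_derivative D) (at y) \<and> Im D = 0"
    for ls x
  proof (cases "x = 0")
    case True
    then show ?thesis using ls by (simp add: A_arc_0)
  next
    case False
    \<comment> \<open>At the point 0 only the existence of a derivative matters, as it gives
      continuity up to the endpoint.\<close>
    have dIm: "\<exists>D. ((\<lambda>x. Im (A_arc ls x)) has_real_derivative D) (at y) \<and> (y > 0 \<longrightarrow> D = 0)"
      if y: "0 \<le> y" "y < pi" for y
    proof (cases "y = 0")
      case True
      obtain D where "(A_arc ls has_vector_derivative D) (at 0)"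
        using A_arc_differentiable_0[OF ls(1)] .
      from bounded_linear.has_vector_derivative[OF bounded_linear_Im this] True
      show ?thesis
        by (intro exI[of _ "Im D"]) (simp add: has_real_derivative_iff_has_vector_derivative)
    next
      case False
      then obtain D where "(A_arc ls has_vector_derivative D) (at y)" "Im D = 0"
        using d[of y] y by auto
      with bounded_linear.has_vector_derivative[OF bounded_linear_Im this(1)]
      show ?thesis
        by (intro exI[of _ "Im D"]) (simp add: has_real_derivative_iff_has_vector_derivative)
    qed
    have "continuous_on {0..x} (\<lambda>x. Im (A_arc ls x))"
    proof (intro continuous_at_imp_continuous_on ballI)
      show "isCont (\<lambda>x. Im (A_arc ls x)) y" if "y \<in> {0..x}" for y
      proof -
        have "0 \<le> y" "y < pi" using that x by auto
        then show ?thesis using dIm DERIV_isCont by blast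
      qed
    qed
    then have "Im (A_arc ls x) = Im (A_arc ls 0)"
    proof (rule DERIV_isconst_end[rotated])
      show "((\<lambda>x. Im (A_arc ls x)) has_real_derivative 0) (at y)" if "0 < y" "y < x" for y
      proof -
        have "0 \<le> y" "y < pi" using that x by auto
        then show ?thesis using dIm[of y] that by auto
      qed
    qed (use False x in auto)
    then show ?thesis using ls by (simp add: A_arc_0)
  qed
  from snoc.prems have "1 \<le> k" "is_index ks" by (auto simp: is_index_def)
  from this(1) snoc.prems(2,3) show ?case
  proof (induction k arbitrary: x rule: dec_induct)
    case base
    show ?case
    proof (rule zero)
      show "is_index (ks @ [1])"
        using \<open>is_index ks\<close> by (auto simp: is_index_def)
      show "\<exists>D. (A_arc (ks @ [1]) has_vector_derivative D) (at y) \<and> Im D = 0" if "0 < y" "y < pi" for y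
        using A_arc_deriv_snoc_1[OF \<open>is_index ks\<close>, of y] snoc.IH[OF \<open>is_index ks\<close>, of y] that
        by (intro exI[of _ "A_arc ks y"]) simp
    qed (use base in auto)
  next
    case (step k)
    show ?case
    proof (rule zero)
      have k: "is_index (ks @ [k])"
        using \<open>is_index ks\<close> step.hyps by (auto simp: is_index_def)
      show "is_index (ks @ [Suc k])"
        using \<open>is_index ks\<close> by (auto simp: is_index_def)
      show "\<exists>D. (A_arc (ks @ [Suc k]) has_vector_derivative D) (at y) \<and> Im D = 0"
        if "0 < y" "y < pi" for y
        using A_arc_deriv_snoc_Suc[OF k that] step.IH[of y] that
        by (intro exI[of _ "A_arc (ks @ [k]) y / of_real (sin y)"]) simp
    qed (use step.prems in auto)
  qed
qed

lemma multA_i: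
  assumes "is_index ks"
  shows "multA ks \<i> = \<i> ^ length ks * of_real (A_real ks (pi / 2))"
proof -
  have "A_arc ks (pi / 2) = of_real (A_real ks (pi / 2))"
    using Im_A_arc[OF assms, of "pi / 2"] by (simp add: A_real_def complex_eq_iff)
  then show ?thesis
    by (simp add: A_arc_def tan_45 field_simps)
qed

subsection \<open>Integration by parts\<close>

definition log_tan :: "real \<Rightarrow> real"
  where "log_tan x = ln (tan (x / 2))"

lemma log_tan_deriv:
  assumes "0 < x" "x < pi"
  shows "(log_tan has_real_derivative 1 / sin x) (at x)"
proof -
  have t: "tan (x / 2) > 0" and c: "cos (x / 2) \<noteq> 0"
    using tan_half_pos[of x] cos_half_pos[of x] assms by auto
  have "(log_tan has_real_derivative 1 / tan (x / 2) * ((1 + (tan (x / 2))\<^sup>2) / 2)) (at x)"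
    unfolding log_tan_def
    using t c by (auto intro!: derivative_eq_intros simp: tan_sec inverse_eq_divide power_divide)
  also have "1 / tan (x / 2) * ((1 + (tan (x / 2))\<^sup>2) / 2) = 1 / sin x"
    using sin_tan_half[of "x / 2"] by simp
  finally show ?thesis .
qed

lemma log_tan_pi_half [simp]: "log_tan (pi / 2) = 0"
  by (simp add: log_tan_def tan_45)

lemma log_tan_power_tendsto: "((\<lambda>x. x * log_tan x ^ b) \<longlongrightarrow> 0) (at_right 0)"
  unfolding log_tan_def by real_asymp

lemma log_tan_A_real_tendsto:
  assumes "is_index ks" "ks \<noteq> []"
  shows "((\<lambda>x. log_tan x ^ b * A_real ks x) \<longlongrightarrow> 0) (at_right 0)"
proof -
  obtain D where "((\<lambda>x. A_real ks x / x) \<longlongrightarrow> D) (at_right 0)"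
    using A_real_div_tendsto[OF assms] .
  from tendsto_mult[OF log_tan_power_tendsto this]
  have "((\<lambda>x. x * log_tan x ^ b * (A_real ks x / x)) \<longlongrightarrow> 0) (at_right 0)"
    by simp
  moreover have "\<forall>\<^sub>F x in at_right 0. x * log_tan x ^ b * (A_real ks x / x) = log_tan x ^ b * A_real ks x"
    using eventually_at_right_less by eventually_elim simp
  ultimately show ?thesis
    by (rule Lim_transform_eventually)
qed

section \<open>Rational combinations of functions and primitives normalised at 0\<close>

text \<open>Functions are compared only on \<open>(0, \<pi>)\<close>, where all functions below are smooth.\<close>

inductive_set rat_comb :: "(real \<Rightarrow> real) set \<Rightarrow> (real \<Rightarrow> real) set" for S where
  zero: "(\<And>x. x \<in> {0<..<pi} \<Longrightarrow> f x = 0) \<Longrightarrow> f \<in> rat_comb S"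
| step: "g \<in> rat_comb S \<Longrightarrow> s \<in> S \<Longrightarrow>
    (\<And>x. x \<in> {0<..<pi} \<Longrightarrow> f x = of_rat q * s x + g x) \<Longrightarrow> f \<in> rat_comb S"

lemma rat_comb_cong:
  assumes "f \<in> rat_comb S" "\<And>x. x \<in> {0<..<pi} \<Longrightarrow> f x = g x"
  shows "g \<in> rat_comb S"
  using assms(1)
proof cases
  case zero
  then show ?thesis using assms(2) by (intro rat_comb.zero) auto
next
  case (step h s q)
  then show ?thesis using assms(2) by (intro rat_comb.step[of h S s g q]) auto
qed

lemma rat_comb_base: "s \<in> S \<Longrightarrow> s \<in> rat_comb S"
  by (rule rat_comb.step[of "\<lambda>_. 0" S s s 1]) (auto intro: rat_comb.zero)

lemma rat_comb_add:
  assumes "f \<in> rat_comb S" "g \<in> rat_comb S"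
  shows "(\<lambda>x. f x + g x) \<in> rat_comb S"
  using assms(1)
proof induction
  case (zero f)
  then show ?case using rat_comb_cong[OF assms(2)] by simp
next
  case (step h s f q)
  then show ?case by (intro rat_comb.step[OF step.IH step.hyps(2), where q = q]) auto
qed

lemma rat_comb_scale: "f \<in> rat_comb S \<Longrightarrow> (\<lambda>x. of_rat q * f x) \<in> rat_comb S"
proof (induction rule: rat_comb.induct)
  case (zero f)
  then show ?case by (intro rat_comb.zero) auto
next
  case (step h s f r)
  then show ?case
    by (intro rat_comb.step[OF step.IH step.hyps(2), where q = "q * r"])
      (simp only: step.hyps(3) of_rat_mult distrib_left mult.assoc)
qed

lemma rat_comb_diff_scale:
  assumes "f \<in> rat_comb S" "g \<in> rat_comb S"
  shows "(\<lambda>x. f x - of_rat q * g x) \<in> rat_comb S"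
  using rat_comb_add[OF assms(1) rat_comb_scale[OF assms(2), of "- q"]]
  by (simp add: of_rat_minus)

lemma rat_comb_mult:
  assumes "f \<in> rat_comb S" "\<And>s. s \<in> S \<Longrightarrow> (\<lambda>x. w x * s x) \<in> rat_comb T"
  shows "(\<lambda>x. w x * f x) \<in> rat_comb T"
  using assms(1)
proof induction
  case (zero f)
  then show ?case by (intro rat_comb.zero) auto
next
  case (step g s f q)
  have "(\<lambda>x. of_rat q * (w x * s x) + w x * g x) \<in> rat_comb T"
    by (intro rat_comb_add rat_comb_scale assms(2) step)
  then show ?case
    by (rule rat_comb_cong) (simp add: step.hyps(3) algebra_simps)
qed

lemma eventually_in_interval_at_right: "\<forall>\<^sub>F x in at_right 0. x \<in> {0<..<pi}"
  using eventually_at_right_real[OF pi_gt_zero] .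

lemma rat_comb_tendsto_0:
  assumes "f \<in> rat_comb S" "\<And>s. s \<in> S \<Longrightarrow> (s \<longlongrightarrow> 0) (at_right 0)"
  shows "(f \<longlongrightarrow> 0) (at_right 0)"
  using assms(1)
proof induction
  case (zero f)
  have "\<forall>\<^sub>F x in at_right 0. 0 = f x"
    using eventually_in_interval_at_right by eventually_elim (simp add: zero)
  with tendsto_const show ?case
    by (rule Lim_transform_eventually)
next
  case (step g s f q)
  have "((\<lambda>x. of_rat q * s x + g x) \<longlongrightarrow> 0) (at_right 0)"
    using assms(2)[OF step.hyps(2)] step.IH by (auto intro!: tendsto_eq_intros)
  then show ?case
    by (rule Lim_transform_eventually, intro eventually_mono[OF eventually_in_interval_at_right])
      (simp add: step.hyps(3))
qed

lemma rat_comb_eval: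
  assumes "f \<in> rat_comb S" "x \<in> {0<..<pi}"
  shows "f x \<in> rat_span ((\<lambda>s. s x) ` S)"
  using assms(1)
proof induction
  case (zero f)
  then show ?case using assms(2) by (simp add: rat_real.span_zero)
next
  case (step g s f q)
  have "of_rat q * s x + g x \<in> rat_span ((\<lambda>s. s x) ` S)"
    using step.hyps(2) by (intro rat_real.span_add[OF rat_real.span_scale[OF rat_real.span_base] step.IH]) auto
  then show ?case using assms(2) by (simp add: step.hyps(3))
qed

text \<open>The integral of \<open>f\<close> from 0 without integration theory. The normalisation is
  a one-sided limit, since the values at 0 are uncontrolled for functions known only on
  \<open>(0, pi)\<close>.\<close>

definition antideriv :: "(real \<Rightarrow> real) \<Rightarrow> (real \<Rightarrow> real) \<Rightarrow> bool"
  where "antideriv f g \<longleftrightarrow>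
    (\<forall>x\<in>{0<..<pi}. (g has_real_derivative f x) (at x)) \<and> (g \<longlongrightarrow> 0) (at_right 0)"

lemma antideriv_cong:
  "antideriv f g \<Longrightarrow> (\<And>x. x \<in> {0<..<pi} \<Longrightarrow> f x = f' x) \<Longrightarrow> antideriv f' g"
  by (simp add: antideriv_def)

lemma antideriv_add: "antideriv f g \<Longrightarrow> antideriv f' g' \<Longrightarrow> antideriv (\<lambda>x. f x + f' x) (\<lambda>x. g x + g' x)"
  unfolding antideriv_def by (auto intro!: derivative_eq_intros tendsto_eq_intros)

lemma antideriv_cmult: "antideriv f g \<Longrightarrow> antideriv (\<lambda>x. c * f x) (\<lambda>x. c * g x)"
  unfolding antideriv_def by (auto intro!: derivative_eq_intros tendsto_eq_intros)

text \<open>Two primitives differ by a constant, and the limits at 0 make it 0. Identities between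
  iterated integrals are obtained below by exhibiting two primitives of one function.\<close>

lemma antideriv_unique:
  assumes "antideriv f g" "antideriv f h" "x \<in> {0<..<pi}"
  shows "g x = h x"
proof -
  have "((\<lambda>x. g x - h x) has_real_derivative 0) (at y within {0<..<pi})" if "y \<in> {0<..<pi}" for y
  proof -
    have "(g has_real_derivative f y) (at y)" "(h has_real_derivative f y) (at y)"
      using assms(1,2) that by (simp_all add: antideriv_def)
    from DERIV_diff[OF this] show ?thesis
      by (simp add: has_field_derivative_at_within)
  qed
  then obtain c where c: "\<forall>y\<in>{0<..<pi}. g y - h y = c"
    using has_field_derivative_zero_constant[of "{0<..<pi}" "\<lambda>x. g x - h x"] by (auto simp del: greaterThanLessThan_iff)
  have "((\<lambda>x. g x - h x) \<longlongrightarrow> 0) (at_right 0)"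
    using assms(1,2) unfolding antideriv_def by (auto intro!: tendsto_eq_intros)
  moreover have "((\<lambda>x. g x - h x) \<longlongrightarrow> c) (at_right 0)"
    by (rule Lim_transform_eventually[OF tendsto_const], intro eventually_mono[OF eventually_in_interval_at_right])
      (simp add: c)
  ultimately have "c = 0"
    by (rule tendsto_unique[OF trivial_limit_at_right_real, symmetric])
  with c assms(3) show ?thesis by simp
qed

text \<open>The weight function \<open>w\<close> covers both integrations in use, \<open>dx\<close>
  with \<open>w = 1\<close> and \<open>dx / sin x\<close>.\<close>

lemma rat_comb_antideriv:
  assumes "f \<in> rat_comb S"
    and "\<And>s. s \<in> S \<Longrightarrow> \<exists>g\<in>rat_comb T. antideriv (\<lambda>x. w x * s x) g"
  shows "\<exists>g\<in>rat_comb T. antideriv (\<lambda>x. w x * f x) g"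
  using assms(1)
proof induction
  case (zero f)
  then show ?case
    by (intro bexI[of _ "\<lambda>_. 0"]) (auto simp: antideriv_def intro: rat_comb.zero)
next
  case (step h s f q)
  obtain g g' where g: "g \<in> rat_comb T" "antideriv (\<lambda>x. w x * s x) g"
    "g' \<in> rat_comb T" "antideriv (\<lambda>x. w x * h x) g'"
    using step.IH assms(2)[OF step.hyps(2)] by blast
  show ?case
  proof (intro bexI)
    show "antideriv (\<lambda>x. w x * f x) (\<lambda>x. of_rat q * g x + g' x)"
      by (rule antideriv_cong[OF antideriv_add[OF antideriv_cmult[OF g(2)] g(4)]])
        (simp add: step.hyps(3) algebra_simps)
  qed (intro rat_comb_add rat_comb_scale g)
qed

section \<open>Iterated log-tangent integrals as combinations of A-functions\<close>

definition A_gens :: "nat \<Rightarrow> nat \<Rightarrow> (real \<Rightarrow> real) set"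
  where "A_gens k d = {A_real ks | ks. is_index ks \<and> weight ks = k \<and> length ks = d}"

text \<open>A logarithm counts 1 towards the weight \<open>k\<close> and 0 towards the depth
  \<open>d\<close>. Both gradings are kept because the parity of their sum separates the even from
  the odd spaces.\<close>

definition log_A_gens :: "nat \<Rightarrow> nat \<Rightarrow> (real \<Rightarrow> real) set"
  where "log_A_gens k d = {\<lambda>x. log_tan x ^ b * A_real ks x | b ks.
    is_index ks \<and> b + weight ks = k \<and> length ks = d}"

lemma log_A_gensI: "is_index ks \<Longrightarrow> (\<lambda>x. log_tan x ^ b * A_real ks x) \<in> log_A_gens (b + weight ks) (length ks)"
  by (auto simp: log_A_gens_def)

lemma is_index_snoc: "is_index (ks @ [k]) \<longleftrightarrow> is_index ks \<and> 1 \<le> k"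
  by (auto simp: is_index_def)

lemma weight_snoc: "weight (ks @ [k]) = weight ks + k"
  by (simp add: weight_def)

lemma antideriv_A_real_snoc_1:
  "is_index ks \<Longrightarrow> antideriv (A_real ks) (A_real (ks @ [1]))"
  using A_real_deriv_snoc_1[of ks] log_tan_A_real_tendsto[of "ks @ [1]" 0]
  by (simp add: antideriv_def is_index_snoc)

lemma antideriv_A_real_snoc_Suc:
  "is_index (ks @ [k]) \<Longrightarrow> antideriv (\<lambda>x. 1 / sin x * A_real (ks @ [k]) x) (A_real (ks @ [Suc k]))"
  using A_real_deriv_snoc_Suc[of ks k] log_tan_A_real_tendsto[of "ks @ [Suc k]" 0]
  by (simp add: antideriv_def is_index_snoc)

lemma log_tan_power_deriv:
  assumes "0 < x" "x < pi"
  shows "((\<lambda>x. log_tan x ^ Suc b) has_real_derivative real (Suc b) * log_tan x ^ b / sin x) (at x)"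
  using DERIV_power[OF log_tan_deriv[OF assms], of "Suc b"]
  by (simp add: mult_ac del: power_Suc of_nat_Suc)

text \<open>Integration by parts, moving the derivative from \<open>g\<close> to the power of the logarithm.\<close>

lemma antideriv_by_parts:
  assumes "antideriv f g" "((\<lambda>x. log_tan x ^ Suc b * g x) \<longlongrightarrow> 0) (at_right 0)"
    and "antideriv (\<lambda>x. 1 / sin x * (log_tan x ^ b * g x)) h"
  shows "antideriv (\<lambda>x. log_tan x ^ Suc b * f x) (\<lambda>x. log_tan x ^ Suc b * g x - real (Suc b) * h x)"
  unfolding antideriv_def
proof (intro conjI ballI)
  fix x :: real assume x: "x \<in> {0<..<pi}"
  then have "(g has_real_derivative f x) (at x)"
    "(h has_real_derivative 1 / sin x * (log_tan x ^ b * g x)) (at x)"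
    "((\<lambda>x. log_tan x ^ Suc b) has_real_derivative real (Suc b) * log_tan x ^ b / sin x) (at x)"
    using assms(1,3) log_tan_power_deriv[of x b] by (simp_all add: antideriv_def del: power_Suc of_nat_Suc)
  from DERIV_diff[OF DERIV_mult[OF this(3,1)] DERIV_cmult[OF this(2), of "real (Suc b)"]]
  show "((\<lambda>x. log_tan x ^ Suc b * g x - real (Suc b) * h x) has_real_derivative
      log_tan x ^ Suc b * f x) (at x)"
    by (simp add: mult_ac del: power_Suc of_nat_Suc)
next
  have "(h \<longlongrightarrow> 0) (at_right 0)"
    using assms(3) by (simp add: antideriv_def)
  then show "((\<lambda>x. log_tan x ^ Suc b * g x - real (Suc b) * h x) \<longlongrightarrow> 0) (at_right 0)"
    using tendsto_diff[OF assms(2) tendsto_mult_right_zero] by fastforce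
qed

text \<open>Since \<open>dx / sin x\<close> is the differential of \<open>log_tan\<close>,
  integration by parts trades one logarithm for an increase of the last entry by 1. This preserves
  the weight, and the induction on \<open>b\<close> must allow all \<open>k\<close>.\<close>

lemma log_A_antideriv_sin:
  assumes "is_index (ks @ [k])"
  shows "\<exists>g\<in>rat_comb (log_A_gens (Suc (b + weight (ks @ [k]))) (Suc (length ks))).
    antideriv (\<lambda>x. 1 / sin x * (log_tan x ^ b * A_real (ks @ [k]) x)) g"
  using assms
proof (induction b arbitrary: k)
  case 0
  have "is_index (ks @ [Suc k])"
    using 0 by (simp add: is_index_snoc)
  from log_A_gensI[OF this, of 0] antideriv_A_real_snoc_Suc[OF 0] show ?case
    by (intro bexI[of _ "A_real (ks @ [Suc k])"] rat_comb_base) (simp_all add: weight_snoc)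
next
  case (Suc b)
  have idx: "is_index (ks @ [Suc k])"
    using Suc.prems by (simp add: is_index_snoc)
  obtain h where h: "h \<in> rat_comb (log_A_gens (Suc (b + weight (ks @ [Suc k]))) (Suc (length ks)))"
    "antideriv (\<lambda>x. 1 / sin x * (log_tan x ^ b * A_real (ks @ [Suc k]) x)) h"
    using Suc.IH[OF idx] by blast
  have "antideriv (\<lambda>x. log_tan x ^ Suc b * (1 / sin x * A_real (ks @ [k]) x))
      (\<lambda>x. log_tan x ^ Suc b * A_real (ks @ [Suc k]) x - real (Suc b) * h x)"
    by (intro antideriv_by_parts antideriv_A_real_snoc_Suc Suc.prems log_tan_A_real_tendsto idx h(2)) simp
  then have "antideriv (\<lambda>x. 1 / sin x * (log_tan x ^ Suc b * A_real (ks @ [k]) x))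
      (\<lambda>x. log_tan x ^ Suc b * A_real (ks @ [Suc k]) x - of_rat (of_nat (Suc b)) * h x)"
    by (simp only: mult_ac of_rat_of_nat_eq)
  moreover have "(\<lambda>x. log_tan x ^ Suc b * A_real (ks @ [Suc k]) x) \<in>
      log_A_gens (Suc (Suc b + weight (ks @ [k]))) (Suc (length ks))"
    using log_A_gensI[OF idx, of "Suc b"] by (simp add: weight_snoc)
  moreover have "h \<in> rat_comb (log_A_gens (Suc (Suc b + weight (ks @ [k]))) (Suc (length ks)))"
    using h(1) by (simp add: weight_snoc)
  ultimately show ?case
    by (intro bexI[of _ "\<lambda>x. log_tan x ^ Suc b * A_real (ks @ [Suc k]) x - of_rat (of_nat (Suc b)) * h x"]
        rat_comb_diff_scale[OF rat_comb_base])
qed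

text \<open>A single integration by parts appends the entry 1 and replaces \<open>dx\<close> by
  \<open>dx / sin x\<close>, which is the case already treated.\<close>

lemma log_A_antideriv:
  assumes "is_index ks"
  shows "\<exists>g\<in>rat_comb (log_A_gens (Suc (b + weight ks)) (Suc (length ks))).
    antideriv (\<lambda>x. log_tan x ^ b * A_real ks x) g"
proof (cases b)
  case 0
  have "is_index (ks @ [1])"
    using assms by (simp add: is_index_snoc)
  from log_A_gensI[OF this, of 0] antideriv_A_real_snoc_1[OF assms] show ?thesis
    by (intro bexI[of _ "A_real (ks @ [1])"] rat_comb_base) (simp_all add: weight_snoc 0)
next
  case (Suc b')
  have idx: "is_index (ks @ [1])"
    using assms by (simp add: is_index_snoc)
  obtain h where h: "h \<in> rat_comb (log_A_gens (Suc (b' + weight (ks @ [1]))) (Suc (length ks)))"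
    "antideriv (\<lambda>x. 1 / sin x * (log_tan x ^ b' * A_real (ks @ [1]) x)) h"
    using log_A_antideriv_sin[OF idx] by blast
  have "antideriv (\<lambda>x. log_tan x ^ b * A_real ks x)
      (\<lambda>x. log_tan x ^ b * A_real (ks @ [1]) x - real b * h x)"
    unfolding Suc
    by (intro antideriv_by_parts antideriv_A_real_snoc_1 assms log_tan_A_real_tendsto idx h(2)) simp
  then have "antideriv (\<lambda>x. log_tan x ^ b * A_real ks x)
      (\<lambda>x. log_tan x ^ b * A_real (ks @ [1]) x - of_rat (of_nat b) * h x)"
    by (simp only: of_rat_of_nat_eq)
  moreover have "(\<lambda>x. log_tan x ^ b * A_real (ks @ [1]) x) \<in>
      log_A_gens (Suc (b + weight ks)) (Suc (length ks))"
    using log_A_gensI[OF idx, of b] by (simp add: weight_snoc)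
  moreover have "h \<in> rat_comb (log_A_gens (Suc (b + weight ks)) (Suc (length ks)))"
    using h(1) by (simp add: weight_snoc Suc)
  ultimately show ?thesis
    by (intro bexI[of _ "\<lambda>x. log_tan x ^ b * A_real (ks @ [1]) x - of_rat (of_nat b) * h x"]
        rat_comb_diff_scale[OF rat_comb_base])
qed

lemma rat_comb_log_A_antideriv:
  assumes "f \<in> rat_comb (log_A_gens k d)"
  shows "\<exists>g\<in>rat_comb (log_A_gens (Suc k) (Suc d)). antideriv f g"
proof -
  have "\<exists>g\<in>rat_comb (log_A_gens (Suc k) (Suc d)). antideriv (\<lambda>x. 1 * f x) g"
    using assms
  proof (rule rat_comb_antideriv)
    fix s assume "s \<in> log_A_gens k d"
    then show "\<exists>g\<in>rat_comb (log_A_gens (Suc k) (Suc d)). antideriv (\<lambda>x. 1 * s x) g"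
      using log_A_antideriv by (auto simp: log_A_gens_def)
  qed
  then show ?thesis by simp
qed

lemma rat_comb_log_A_mult_log:
  assumes "f \<in> rat_comb (log_A_gens k d)"
  shows "(\<lambda>x. log_tan x ^ a * f x) \<in> rat_comb (log_A_gens (a + k) d)"
  using assms
proof (rule rat_comb_mult)
  fix s assume "s \<in> log_A_gens k d"
  then obtain b ks where s: "s = (\<lambda>x. log_tan x ^ b * A_real ks x)" "is_index ks"
    "b + weight ks = k" "length ks = d"
    by (auto simp: log_A_gens_def)
  have "(\<lambda>x. log_tan x ^ (a + b) * A_real ks x) \<in> log_A_gens (a + k) d"
    using log_A_gensI[OF s(2), of "a + b"] unfolding s(3,4)[symmetric] by (simp add: add.assoc)
  then show "(\<lambda>x. log_tan x ^ a * s x) \<in> rat_comb (log_A_gens (a + k) d)"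
    by (intro rat_comb_base) (simp add: s(1) power_add mult.assoc)
qed

text \<open>Multiplication by \<open>x = A_real [1] x\<close>: the shuffle product with a single letter.\<close>

lemma A_real_mult_x:
  assumes "is_index ks"
  shows "(\<lambda>x. x * A_real ks x) \<in> rat_comb (A_gens (Suc (weight ks)) (Suc (length ks)))"
  using assms
proof (induction ks rule: rev_induct)
  case Nil
  have "antideriv (A_real []) (\<lambda>x. x)"
    by (auto simp: antideriv_def A_real_Nil intro!: derivative_eq_intros tendsto_eq_intros)
  moreover have "antideriv (A_real []) (A_real [1])"
    using antideriv_A_real_snoc_1[of "[]"] by (simp add: is_index_def)
  ultimately have "A_real [1] x = x * A_real [] x" if "x \<in> {0<..<pi}" for x
    using antideriv_unique[of "A_real []" "A_real [1]" "\<lambda>x. x" x] that by (simp add: A_real_Nil)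
  moreover have "A_real [1] \<in> A_gens 1 1"
    by (auto simp: A_gens_def is_index_def weight_def)
  ultimately show ?case
    by (intro rat_comb_cong[OF rat_comb_base, of "A_real [1]"]) (simp_all add: weight_def)
next
  case (snoc k ks)
  \<comment> \<open>The product rule for \<open>x * A_real ls x\<close>. Both cases below compare
    this primitive with one assembled from the induction hypothesis.\<close>
  have mult_x: "antideriv (\<lambda>x. 1 * A_real ls x + x * f x) (\<lambda>x. x * A_real ls x)"
    if "antideriv f (A_real ls)" for f ls
    using that by (auto simp: antideriv_def intro!: derivative_eq_intros tendsto_eq_intros)
  from snoc.prems have "1 \<le> k" "is_index ks" by (simp_all add: is_index_snoc)
  from this(1) show ?case
  proof (induction k rule: dec_induct)
    case base
    let ?R = "rat_comb (A_gens (Suc (weight (ks @ [1]))) (Suc (length (ks @ [1]))))"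
    have "\<exists>g\<in>?R. antideriv (\<lambda>x. 1 * (x * A_real ks x)) g"
      using snoc.IH[OF \<open>is_index ks\<close>]
    proof (rule rat_comb_antideriv)
      fix s assume "s \<in> A_gens (Suc (weight ks)) (Suc (length ks))"
      then obtain ls where "s = A_real ls" "is_index ls" "weight ls = Suc (weight ks)"
        "length ls = Suc (length ks)"
        by (auto simp: A_gens_def)
      then show "\<exists>g\<in>?R. antideriv (\<lambda>x. 1 * s x) g"
        using antideriv_A_real_snoc_1[of ls]
        by (intro bexI[of _ "A_real (ls @ [1])"] rat_comb_base)
          (auto simp: A_gens_def is_index_snoc weight_snoc)
    qed
    then obtain g where g: "g \<in> ?R" "antideriv (\<lambda>x. x * A_real ks x) g"
      by auto
    have idx: "is_index (ks @ [1])" "is_index ((ks @ [1]) @ [1])"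
      using \<open>is_index ks\<close> by (simp_all add: is_index_snoc del: append_assoc)
    have 1: "antideriv (\<lambda>x. 1 * A_real (ks @ [1]) x + x * A_real ks x)
        (\<lambda>x. A_real ((ks @ [1]) @ [1]) x + g x)"
      using antideriv_add[OF antideriv_A_real_snoc_1[OF idx(1)] g(2)] by simp
    have 2: "antideriv (\<lambda>x. 1 * A_real (ks @ [1]) x + x * A_real ks x) (\<lambda>x. x * A_real (ks @ [1]) x)"
      by (intro mult_x antideriv_A_real_snoc_1 \<open>is_index ks\<close>)
    have 3: "A_real ((ks @ [1]) @ [1]) \<in> ?R"
      using idx(2) by (intro rat_comb_base) (auto simp: A_gens_def weight_snoc simp del: append_assoc)
    from rat_comb_cong[OF rat_comb_add[OF 3 g(1)] antideriv_unique[OF 1 2]] show ?case .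
  next
    case (step k)
    let ?R = "rat_comb (A_gens (Suc (weight (ks @ [Suc k]))) (Suc (length (ks @ [Suc k]))))"
    have "\<exists>g\<in>?R. antideriv (\<lambda>x. 1 / sin x * (x * A_real (ks @ [k]) x)) g"
      using step.IH
    proof (rule rat_comb_antideriv)
      fix s assume "s \<in> A_gens (Suc (weight (ks @ [k]))) (Suc (length (ks @ [k])))"
      then obtain ls' where s: "s = A_real ls'" "is_index ls'" "weight ls' = Suc (weight (ks @ [k]))"
        "length ls' = Suc (length (ks @ [k]))"
        by (auto simp: A_gens_def)
      \<comment> \<open>The summands have positive depth, so there is a last entry which the form
        \<open>dx / sin x\<close> can raise.\<close>
      then obtain ls j where "ls' = ls @ [j]"
        by (cases ls' rule: rev_cases) auto
      with s show "\<exists>g\<in>?R. antideriv (\<lambda>x. 1 / sin x * s x) g"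
        using antideriv_A_real_snoc_Suc[of ls j]
        by (intro bexI[of _ "A_real (ls @ [Suc j])"] rat_comb_base)
          (auto simp: A_gens_def is_index_snoc weight_snoc)
    qed
    then obtain g where g: "g \<in> ?R" "antideriv (\<lambda>x. 1 / sin x * (x * A_real (ks @ [k]) x)) g"
      by auto
    have idx: "is_index (ks @ [k])" "is_index (ks @ [Suc k])" "is_index ((ks @ [Suc k]) @ [1])"
      using \<open>is_index ks\<close> step.hyps by (simp_all add: is_index_snoc del: append_assoc)
    have 1: "antideriv (\<lambda>x. 1 * A_real (ks @ [Suc k]) x + x * (1 / sin x * A_real (ks @ [k]) x))
        (\<lambda>x. A_real ((ks @ [Suc k]) @ [1]) x + g x)"
      using antideriv_add[OF antideriv_A_real_snoc_1[OF idx(2)] g(2)] by (simp add: mult_ac)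
    have 2: "antideriv (\<lambda>x. 1 * A_real (ks @ [Suc k]) x + x * (1 / sin x * A_real (ks @ [k]) x))
        (\<lambda>x. x * A_real (ks @ [Suc k]) x)"
      by (intro mult_x antideriv_A_real_snoc_Suc idx)
    have 3: "A_real ((ks @ [Suc k]) @ [1]) \<in> ?R"
      using idx(3) by (intro rat_comb_base) (auto simp: A_gens_def weight_snoc simp del: append_assoc)
    from rat_comb_cong[OF rat_comb_add[OF 3 g(1)] antideriv_unique[OF 1 2]] show ?case .
  qed
qed

text \<open>The power of the logarithm is carried along; a factor \<open>x\<close> behaves like the
  index \<open>[1]\<close> and adds 1 to both weight and depth.\<close>

lemma rat_comb_log_A_mult_x:
  assumes "f \<in> rat_comb (log_A_gens k d)"
  shows "(\<lambda>x. x * f x) \<in> rat_comb (log_A_gens (Suc k) (Suc d))"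
  using assms
proof (rule rat_comb_mult)
  fix s assume "s \<in> log_A_gens k d"
  then obtain b ks where s: "s = (\<lambda>x. log_tan x ^ b * A_real ks x)" "is_index ks"
    "b + weight ks = k" "length ks = d"
    by (auto simp: log_A_gens_def)
  have "(\<lambda>x. log_tan x ^ b * (x * A_real ks x)) \<in> rat_comb (log_A_gens (Suc k) (Suc d))"
    using A_real_mult_x[OF s(2)]
  proof (rule rat_comb_mult)
    fix s' assume "s' \<in> A_gens (Suc (weight ks)) (Suc (length ks))"
    then obtain ls where "s' = A_real ls" "is_index ls" "weight ls = Suc (weight ks)" "length ls = Suc (length ks)"
      by (auto simp: A_gens_def)
    then show "(\<lambda>x. log_tan x ^ b * s' x) \<in> rat_comb (log_A_gens (Suc k) (Suc d))"
      using log_A_gensI[of ls b] s(3,4) by (intro rat_comb_base) simp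
  qed
  then show "(\<lambda>x. x * s x) \<in> rat_comb (log_A_gens (Suc k) (Suc d))"
    by (simp add: s(1) mult_ac)
qed

lemma rat_comb_log_A_mult_power:
  assumes "f \<in> rat_comb (log_A_gens k d)"
  shows "(\<lambda>x. x ^ l * f x) \<in> rat_comb (log_A_gens (l + k) (l + d))"
proof (induction l)
  case 0
  then show ?case using assms by simp
next
  case (Suc l)
  from rat_comb_log_A_mult_x[OF this] show ?case by (simp add: mult_ac)
qed

text \<open>\<open>iter_int l a n x\<close> is the integral over \<open>0 < \<theta>\<^sub>0 < \<dots> < \<theta>\<^sub>n\<^sub>-\<^sub>1 < x\<close> of the product
  of the \<open>\<theta>\<^sub>u ^ l u * log_tan \<theta>\<^sub>u ^ a u\<close>.\<close>

primrec iter_int :: "(nat \<Rightarrow> nat) \<Rightarrow> (nat \<Rightarrow> nat) \<Rightarrow> nat \<Rightarrow> real \<Rightarrow> real"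
  where "iter_int l a 0 = (\<lambda>_. 1)"
  | "iter_int l a (Suc n) =
      (SOME g. antideriv (\<lambda>x. x ^ l n * (log_tan x ^ a n * iter_int l a n x)) g)"

text \<open>Both claims are proved together: the choice in \<open>iter_int\<close> is meaningful
  only if a primitive exists, and existence rests on membership of the previous stage in the closed
  class. A power of \<open>x\<close> adds to weight and depth, a logarithm to the weight only, and
  an integration adds 1 to both.\<close>

lemma iter_int_aux:
  "iter_int l a n \<in> rat_comb (log_A_gens (\<Sum>u<n. l u + a u + 1) (\<Sum>u<n. l u + 1)) \<and>
    antideriv (\<lambda>x. x ^ l n * (log_tan x ^ a n * iter_int l a n x)) (iter_int l a (Suc n))"
proof (induction n)
  case 0
  have "(\<lambda>x. log_tan x ^ 0 * A_real [] x) \<in> log_A_gens 0 0"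
    using log_A_gensI[of "[]" 0] by (simp add: is_index_def weight_def)
  then have *: "iter_int l a 0 \<in> rat_comb (log_A_gens 0 0)"
    by (intro rat_comb_base) (simp add: A_real_Nil)
  from rat_comb_log_A_antideriv[OF rat_comb_log_A_mult_power[OF rat_comb_log_A_mult_log[OF this]]]
  have "\<exists>g. antideriv (\<lambda>x. x ^ l 0 * (log_tan x ^ a 0 * iter_int l a 0 x)) g"
    by blast
  from someI_ex[OF this] * show ?case by simp
next
  case (Suc n)
  let ?f = "\<lambda>n x. x ^ l n * (log_tan x ^ a n * iter_int l a n x)"
  have sums: "(\<Sum>u<Suc n. l u + a u + 1) = Suc (l n + (a n + (\<Sum>u<n. l u + a u + 1)))"
    "(\<Sum>u<Suc n. l u + 1) = Suc (l n + (\<Sum>u<n. l u + 1))"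
    by simp_all
  have "\<exists>g\<in>rat_comb (log_A_gens (\<Sum>u<Suc n. l u + a u + 1) (\<Sum>u<Suc n. l u + 1)). antideriv (?f n) g"
    unfolding sums
    using rat_comb_log_A_antideriv[OF rat_comb_log_A_mult_power[OF rat_comb_log_A_mult_log[OF conjunct1[OF Suc]]]] .
  then obtain g where g: "g \<in> rat_comb (log_A_gens (\<Sum>u<Suc n. l u + a u + 1) (\<Sum>u<Suc n. l u + 1))"
    "antideriv (?f n) g"
    by blast
  \<comment> \<open>The chosen primitive coincides on \<open>(0, pi)\<close> with the constructed
    \<open>g\<close>, hence inherits its expansion.\<close>
  from rat_comb_cong[OF g(1) antideriv_unique[OF g(2) conjunct2[OF Suc]]]
  have *: "iter_int l a (Suc n) \<in> rat_comb (log_A_gens (\<Sum>u<Suc n. l u + a u + 1) (\<Sum>u<Suc n. l u + 1))"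
    .
  from rat_comb_log_A_antideriv[OF rat_comb_log_A_mult_power[OF rat_comb_log_A_mult_log[OF this]]]
  have "\<exists>g. antideriv (?f (Suc n)) g"
    by blast
  from someI_ex[OF this] * show ?case by simp
qed

lemmas iter_int_in_rat_comb = iter_int_aux[THEN conjunct1]
lemmas antideriv_iter_int = iter_int_aux[THEN conjunct2]

declare iter_int.simps(2) [simp del]

lemma iter_int_cong:
  assumes "\<And>u. u < n \<Longrightarrow> l u = l' u" "\<And>u. u < n \<Longrightarrow> a u = a' u"
  shows "iter_int l a n = iter_int l' a' n"
  using assms
proof (induction n)
  case (Suc n)
  then have "iter_int l a n = iter_int l' a' n" by simp
  then show ?case using Suc.prems by (simp add: iter_int.simps(2))
qed simp

text \<open>For \<open>n > 0\<close> every generator in the expansion has positive depth, and its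
  linear vanishing at 0 dominates the logarithms.\<close>

lemma log_tan_iter_int_tendsto:
  assumes "n > 0"
  shows "((\<lambda>x. log_tan x ^ b * iter_int l a n x) \<longlongrightarrow> 0) (at_right 0)"
  using rat_comb_log_A_mult_log[OF iter_int_in_rat_comb]
proof (rule rat_comb_tendsto_0)
  fix s assume "s \<in> log_A_gens (b + (\<Sum>u<n. l u + a u + 1)) (\<Sum>u<n. l u + 1)"
  then obtain c ks where s: "s = (\<lambda>x. log_tan x ^ c * A_real ks x)" "is_index ks" "length ks = (\<Sum>u<n. l u + 1)"
    by (auto simp: log_A_gens_def)
  have "(\<Sum>u<n. l u + 1) > 0"
    using assms by (intro sum_pos) auto
  with s(3) have "ks \<noteq> []" by (metis length_greater_0_conv)
  with s(2) show "(s \<longlongrightarrow> 0) (at_right 0)"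
    unfolding s(1) by (rule log_tan_A_real_tendsto)
qed

section \<open>A-functions as combinations of log-tangent integrals without powers of the
  variables\<close>

definition log_iter_gens :: "nat \<Rightarrow> nat \<Rightarrow> (real \<Rightarrow> real) set"
  where "log_iter_gens k d = {\<lambda>x. log_tan x ^ b * iter_int (\<lambda>_. 0) a d x | a b.
    b + (\<Sum>u<d. a u + 1) = k}"

text \<open>A free power of the logarithm becomes the exponent of the next integration variable.
  Only the values of \<open>a\<close> below \<open>d\<close> enter the inner integral, so overriding
  it at \<open>d\<close> is safe.\<close>

lemma iter_int_extend:
  "antideriv (\<lambda>x. log_tan x ^ b * iter_int (\<lambda>_. 0) a d x) (iter_int (\<lambda>_. 0) (a(d := b)) (Suc d))"
proof -
  have "iter_int (\<lambda>_. 0) (a(d := b)) d = iter_int (\<lambda>_. 0) a d"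
    by (rule iter_int_cong) auto
  with antideriv_iter_int[of "\<lambda>_. 0" d "a(d := b)"] show ?thesis by simp
qed

lemma rat_comb_log_iter_antideriv:
  assumes "f \<in> rat_comb (log_iter_gens k d)"
  shows "\<exists>g\<in>rat_comb (log_iter_gens (Suc k) (Suc d)). antideriv f g"
proof -
  have "\<exists>g\<in>rat_comb (log_iter_gens (Suc k) (Suc d)). antideriv (\<lambda>x. 1 * f x) g"
    using assms
  proof (rule rat_comb_antideriv)
    fix s assume "s \<in> log_iter_gens k d"
    then obtain a b where s: "s = (\<lambda>x. log_tan x ^ b * iter_int (\<lambda>_. 0) a d x)" "b + (\<Sum>u<d. a u + 1) = k"
      by (auto simp: log_iter_gens_def)
    have "iter_int (\<lambda>_. 0) (a(d := b)) (Suc d) \<in> log_iter_gens (Suc k) (Suc d)"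
      unfolding log_iter_gens_def using s(2)
      by (intro CollectI exI[of _ "a(d := b)"] exI[of _ 0]) simp
    with iter_int_extend[of b a d]
    show "\<exists>g\<in>rat_comb (log_iter_gens (Suc k) (Suc d)). antideriv (\<lambda>x. 1 * s x) g"
      unfolding s(1) by (intro bexI[OF _ rat_comb_base]) simp_all
  qed
  then show ?thesis by simp
qed

text \<open>Integration by parts with \<open>log_tan ^ Suc b / Suc b\<close> as a primitive of
  \<open>log_tan ^ b / sin\<close>. The derivative of the iterated integral \<open>?F\<close> has a
  factor \<open>log_tan ^ a d\<close>, so the remaining integral \<open>?G\<close> has the same
  depth and \<open>Suc b\<close> more logarithms in its last variable. Positive depth makes the
  boundary term vanish at 0.\<close>

lemma rat_comb_log_iter_antideriv_sin:
  assumes "f \<in> rat_comb (log_iter_gens k (Suc d))"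
  shows "\<exists>g\<in>rat_comb (log_iter_gens (Suc k) (Suc d)). antideriv (\<lambda>x. 1 / sin x * f x) g"
  using assms
proof (rule rat_comb_antideriv)
  fix s assume "s \<in> log_iter_gens k (Suc d)"
  then obtain a b where s: "s = (\<lambda>x. log_tan x ^ b * iter_int (\<lambda>_. 0) a (Suc d) x)"
    "b + (\<Sum>u<Suc d. a u + 1) = k"
    by (auto simp: log_iter_gens_def)
  let ?F = "iter_int (\<lambda>_. 0) a (Suc d)" and ?G = "iter_int (\<lambda>_. 0) (a(d := Suc b + a d)) (Suc d)"
  \<comment> \<open>The factor \<open>of_rat 1\<close> only matches the shape of
    \<open>rat_comb_diff_scale\<close>.\<close>
  let ?g = "\<lambda>x. of_rat (inverse (of_nat (Suc b))) * (log_tan x ^ Suc b * ?F x - of_rat 1 * ?G x)"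
  have "?g \<in> rat_comb (log_iter_gens (Suc k) (Suc d))"
  proof (intro rat_comb_scale rat_comb_diff_scale rat_comb_base)
    show "(\<lambda>x. log_tan x ^ Suc b * ?F x) \<in> log_iter_gens (Suc k) (Suc d)"
      unfolding log_iter_gens_def using s(2)
      by (intro CollectI exI[of _ a] exI[of _ "Suc b"]) simp
    show "?G \<in> log_iter_gens (Suc k) (Suc d)"
      unfolding log_iter_gens_def using s(2)
      by (intro CollectI exI[of _ "a(d := Suc b + a d)"] exI[of _ 0]) simp
  qed
  moreover have "antideriv (\<lambda>x. 1 / sin x * s x) ?g"
    unfolding antideriv_def
  proof (intro conjI ballI)
    fix x :: real assume x: "x \<in> {0<..<pi}"
    have F: "(?F has_real_derivative log_tan x ^ a d * iter_int (\<lambda>_. 0) a d x) (at x)"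
      using antideriv_iter_int[of "\<lambda>_. 0" d a] x by (simp add: antideriv_def)
    have G: "(?G has_real_derivative log_tan x ^ Suc b * (log_tan x ^ a d * iter_int (\<lambda>_. 0) a d x)) (at x)"
      using iter_int_extend[of "Suc b + a d" a d] x
      by (simp add: antideriv_def power_add mult_ac)
    have "sin x \<noteq> 0"
      using x sin_gt_zero[of x] by auto
    have "((\<lambda>x. log_tan x ^ Suc b * ?F x - ?G x) has_real_derivative
        real (Suc b) * log_tan x ^ b / sin x * ?F x) (at x)"
      using DERIV_diff[OF DERIV_mult[OF log_tan_power_deriv[of x b] F] G] x
      by (simp add: mult_ac del: power_Suc of_nat_Suc)
    from DERIV_cmult[OF this, of "of_rat (inverse (of_nat (Suc b)))"]
    show "(?g has_real_derivative 1 / sin x * s x) (at x)"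
      unfolding of_rat_1 mult_1_left
      by (rule DERIV_cong) (simp add: s(1) of_rat_inverse mult.assoc[symmetric] del: of_nat_Suc)
  next
    have "((\<lambda>x. log_tan x ^ Suc b * ?F x) \<longlongrightarrow> 0) (at_right 0)"
      by (rule log_tan_iter_int_tendsto) simp
    moreover have "(?G \<longlongrightarrow> 0) (at_right 0)"
      using log_tan_iter_int_tendsto[of "Suc d" 0 "\<lambda>_. 0" "a(d := Suc b + a d)"] by simp
    ultimately show "(?g \<longlongrightarrow> 0) (at_right 0)"
      using tendsto_mult_right_zero[OF tendsto_diff[of _ 0 _ _ 0, simplified]] by simp
  qed
  ultimately show "\<exists>g\<in>rat_comb (log_iter_gens (Suc k) (Suc d)). antideriv (\<lambda>x. 1 / sin x * s x) g"
    by blast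
qed

text \<open>Appending the entry 1 integrates against \<open>dx\<close> and raises weight and depth;
  increasing the last entry integrates against \<open>dx / sin x\<close> and raises only the
  weight.\<close>

lemma A_real_in_rat_comb_log_iter:
  assumes "is_index ks"
  shows "A_real ks \<in> rat_comb (log_iter_gens (weight ks) (length ks))"
  using assms
proof (induction ks rule: rev_induct)
  case Nil
  have "(\<lambda>x. 1) \<in> log_iter_gens 0 0"
    unfolding log_iter_gens_def by (intro CollectI exI[of _ "\<lambda>_. 0"] exI[of _ 0]) simp
  then show ?case
    by (intro rat_comb_cong[OF rat_comb_base]) (simp_all add: A_real_Nil weight_def)
next
  case (snoc k ks)
  from snoc.prems have "1 \<le> k" and idx: "is_index ks" by (simp_all add: is_index_snoc)
  from this(1) show ?case
  proof (induction k rule: dec_induct)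
    case base
    obtain g where "g \<in> rat_comb (log_iter_gens (Suc (weight ks)) (Suc (length ks)))" "antideriv (A_real ks) g"
      using rat_comb_log_iter_antideriv[OF snoc.IH[OF idx]] by blast
    from rat_comb_cong[OF this(1) antideriv_unique[OF this(2) antideriv_A_real_snoc_1[OF idx]]]
    show ?case
      by (simp add: weight_snoc)
  next
    case (step k)
    have idx': "is_index (ks @ [k])"
      using idx step.hyps by (simp add: is_index_snoc)
    obtain g where "g \<in> rat_comb (log_iter_gens (Suc (weight (ks @ [k]))) (Suc (length ks)))"
      "antideriv (\<lambda>x. 1 / sin x * A_real (ks @ [k]) x) g"
      using rat_comb_log_iter_antideriv_sin[of "A_real (ks @ [k])"] step.IH by fastforce
    from rat_comb_cong[OF this(1) antideriv_unique[OF this(2) antideriv_A_real_snoc_Suc[OF idx']]]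
    show ?case
      by (simp add: weight_snoc)
  qed
qed

subsection \<open>Iterated integrals over the simplex\<close>

lemma log_tan_nonpos:
  assumes "0 < x" "x < pi / 2"
  shows "log_tan x \<le> 0"
proof -
  have "tan (x / 2) < tan (pi / 4)"
    using assms by (intro tan_monotone) auto
  then show ?thesis
    using tan_half_pos[of x] assms by (simp add: log_tan_def tan_45)
qed

text \<open>The fundamental theorem for a nonnegative integrand that may be singular at 0, where the
  limit of the primitive replaces its value. Integrability comes out as a conclusion.\<close>

lemma antideriv_nn_integral:
  assumes "antideriv f g" "0 < \<sigma>" "\<sigma> < pi"
    and nonneg: "\<And>x. 0 < x \<Longrightarrow> x < \<sigma> \<Longrightarrow> 0 \<le> f x"
    and cont: "\<And>x. 0 < x \<Longrightarrow> x < \<sigma> \<Longrightarrow> isCont f x"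
  shows "(\<integral>\<^sup>+x. indicator {0<..<\<sigma>} x * ennreal (f x) \<partial>lborel) = ennreal (g \<sigma>)" "0 \<le> g \<sigma>"
proof -
  have g: "(g has_real_derivative f x) (at x)" if "0 < x" "x \<le> \<sigma>" for x
    using assms(1,3) that by (auto simp: antideriv_def)
  have lim0: "((g \<circ> real_of_ereal) \<longlongrightarrow> 0) (at_right (ereal 0))"
    using assms(1) by (simp add: antideriv_def ereal_tendsto_simps1)
  have "(g \<longlongrightarrow> g \<sigma>) (at_left \<sigma>)"
    using DERIV_isCont[OF g[of \<sigma>]] assms(2) filterlim_at_split by (auto simp: isCont_def)
  then have lim1: "((g \<circ> real_of_ereal) \<longlongrightarrow> g \<sigma>) (at_left (ereal \<sigma>))"
    by (simp add: ereal_tendsto_simps1)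
  note ftc = interval_integral_FTC_nonneg[of "ereal 0" "ereal \<sigma>" g f 0 "g \<sigma>", OF _ _ _ _ lim0 lim1]
  have int: "integrable lborel (\<lambda>x. indicator {0<..<\<sigma>} x * f x)"
    using ftc(1) assms(2) g nonneg cont by (simp add: set_integrable_def)
  have val: "(LINT x|lborel. indicator {0<..<\<sigma>} x * f x) = g \<sigma>"
    using ftc(2) assms(2) g nonneg cont
    by (simp add: interval_lebesgue_integral_def set_lebesgue_integral_def)
  have nn: "0 \<le> indicator {0<..<\<sigma>} x * f x" for x
    using nonneg by (auto simp: indicator_def)
  have "(\<integral>\<^sup>+x. indicator {0<..<\<sigma>} x * ennreal (f x) \<partial>lborel) =
      (\<integral>\<^sup>+x. ennreal (indicator {0<..<\<sigma>} x * f x) \<partial>lborel)"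
    by (intro nn_integral_cong) (auto simp: indicator_def)
  also have "\<dots> = ennreal (g \<sigma>)"
    using nn_integral_eq_integral[OF int] nn val by simp
  finally show "(\<integral>\<^sup>+x. indicator {0<..<\<sigma>} x * ennreal (f x) \<partial>lborel) = ennreal (g \<sigma>)" .
  show "0 \<le> g \<sigma>"
    unfolding val[symmetric] using nn by (rule Bochner_Integration.integral_nonneg)
qed

lemma isCont_iter_int:
  assumes "0 < x" "x < pi"
  shows "isCont (iter_int l a n) x"
proof (cases n)
  case (Suc m)
  then show ?thesis
    using antideriv_iter_int[of l m a] assms by (auto simp: antideriv_def intro: DERIV_isCont)
qed simp

lemma measurable_ordered_simplex [measurable]:
  "Measurable.pred (PiM {..<n} (\<lambda>_. lborel)) (\<lambda>\<theta>. \<theta> \<in> ordered_simplex n \<sigma>)"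
proof -
  \<comment> \<open>Rewritten with quantifiers over finite index sets, the condition is a finite
    combination of measurable predicates.\<close>
  have "(\<lambda>\<theta>. \<theta> \<in> ordered_simplex n \<sigma>) = (\<lambda>\<theta>. (\<forall>u\<in>{..<n}. 0 < \<theta> u \<and> \<theta> u < \<sigma>) \<and>
      (\<forall>i\<in>{..<n}. \<forall>j\<in>{..<n}. i < j \<longrightarrow> \<theta> i < (\<theta> j :: real)))"
    by (auto simp: ordered_simplex_def monotone_on_def fun_eq_iff)
  then show ?thesis
    by simp
qed

lemma measurable_log_tan [measurable]: "log_tan \<in> borel_measurable borel"
  unfolding log_tan_def tan_def by measurable

text \<open>The slice of the simplex at largest coordinate \<open>y\<close> is the simplex of one
  dimension less with upper bound \<open>y\<close>.\<close>

lemma snoc_in_ordered_simplex: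
  "\<theta>(n := y) \<in> ordered_simplex (Suc n) \<sigma> \<longleftrightarrow> 0 < y \<and> y < \<sigma> \<and> \<theta> \<in> ordered_simplex n y"
  (is "?L \<longleftrightarrow> ?R")
proof
  assume L: ?L
  then have mono: "\<And>i j. i < j \<Longrightarrow> j < Suc n \<Longrightarrow> (\<theta>(n := y)) i < (\<theta>(n := y)) j"
    and bd: "\<And>u. u < Suc n \<Longrightarrow> 0 < (\<theta>(n := y)) u \<and> (\<theta>(n := y)) u < \<sigma>"
    by (auto simp: ordered_simplex_def monotone_on_def)
  have "\<theta> i < y" "0 < \<theta> i" if "i < n" for i
    using mono[of i n] bd[of i] that by auto
  moreover have "\<theta> i < \<theta> j" if "i < j" "j < n" for i j
    using mono[of i j] that by auto
  ultimately show ?R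
    using bd[of n] by (auto simp: ordered_simplex_def monotone_on_def)
next
  assume ?R
  then show ?L
    by (auto simp: ordered_simplex_def monotone_on_def less_Suc_eq)
qed

text \<open>On \<open>(0, pi / 2)\<close> the function \<open>- log_tan\<close> is nonnegative, so
  Tonelli applies without prior integrability. The bound \<open>\<sigma>\<close> varies in the
  induction, because the inner integral ends at the largest variable.\<close>

lemma ordered_simplex_nn_integral:
  assumes "0 < \<sigma>" "\<sigma> \<le> pi / 2"
  shows "(\<integral>\<^sup>+\<theta>. indicator (ordered_simplex n \<sigma>) \<theta> *
        ennreal (\<Prod>u<n. \<theta> u ^ l u * (- log_tan (\<theta> u)) ^ a u) \<partial>PiM {..<n} (\<lambda>_. lborel)) =
      ennreal ((- 1) ^ (\<Sum>u<n. a u) * iter_int l a n \<sigma>) \<and>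
    0 \<le> (- 1) ^ (\<Sum>u<n. a u) * iter_int l a n \<sigma>"
  using assms
proof (induction n arbitrary: \<sigma>)
  case 0
  then show ?case
    by (simp add: PiM_empty nn_integral_count_space_finite ordered_simplex_def)
next
  case (Suc n)
  interpret product_sigma_finite "\<lambda>_. lborel :: real measure" ..
  let ?h = "\<lambda>n \<theta>. \<Prod>u<n. \<theta> u ^ l u * (- log_tan (\<theta> u)) ^ a u"
  let ?f = "\<lambda>x. (- 1) ^ (\<Sum>u<Suc n. a u) * (x ^ l n * (log_tan x ^ a n * iter_int l a n x))"
  \<comment> \<open>The signs of all the logarithms are collected in front, so that the integrand
    becomes a multiple of the one defining \<open>iter_int\<close>.\<close>
  have eq: "x ^ l n * (- log_tan x) ^ a n * ((- 1) ^ (\<Sum>u<n. a u) * iter_int l a n x) = ?f x" for x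
  proof -
    have "(- log_tan x) ^ a n = (- 1) ^ a n * log_tan x ^ a n"
      by (simp flip: power_mult_distrib)
    then show ?thesis by (simp add: power_add mult_ac)
  qed
  have pos: "0 \<le> x ^ l n * (- log_tan x) ^ a n" if "0 < x" "x < \<sigma>" for x
    using that Suc.prems log_tan_nonpos[of x] by simp
  have "(\<integral>\<^sup>+\<theta>. indicator (ordered_simplex (Suc n) \<sigma>) \<theta> * ennreal (?h (Suc n) \<theta>)
        \<partial>PiM {..<Suc n} (\<lambda>_. lborel)) =
      (\<integral>\<^sup>+y. (\<integral>\<^sup>+\<theta>. indicator (ordered_simplex (Suc n) \<sigma>) (\<theta>(n := y)) *
        ennreal (?h (Suc n) (\<theta>(n := y))) \<partial>PiM {..<n} (\<lambda>_. lborel)) \<partial>lborel)"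
    unfolding lessThan_Suc
    by (intro product_nn_integral_insert_rev) (simp_all flip: lessThan_Suc)
  also have "\<dots> = (\<integral>\<^sup>+y. indicator {0<..<\<sigma>} y * ennreal (?f y) \<partial>lborel)"
  proof (rule nn_integral_cong)
    fix y :: real
    show "(\<integral>\<^sup>+\<theta>. indicator (ordered_simplex (Suc n) \<sigma>) (\<theta>(n := y)) *
        ennreal (?h (Suc n) (\<theta>(n := y))) \<partial>PiM {..<n} (\<lambda>_. lborel)) =
      indicator {0<..<\<sigma>} y * ennreal (?f y)"
    proof (cases "0 < y \<and> y < \<sigma>")
      case True
      have prod: "?h (Suc n) (\<theta>(n := y)) = y ^ l n * (- log_tan y) ^ a n * ?h n \<theta>" for \<theta>
        by (simp add: mult_ac)
      have "(\<integral>\<^sup>+\<theta>. indicator (ordered_simplex (Suc n) \<sigma>) (\<theta>(n := y)) *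
            ennreal (?h (Suc n) (\<theta>(n := y))) \<partial>PiM {..<n} (\<lambda>_. lborel)) =
          (\<integral>\<^sup>+\<theta>. ennreal (y ^ l n * (- log_tan y) ^ a n) *
            (indicator (ordered_simplex n y) \<theta> * ennreal (?h n \<theta>)) \<partial>PiM {..<n} (\<lambda>_. lborel))"
        unfolding prod ennreal_mult'[OF pos[OF conjunct1[OF True] conjunct2[OF True]]]
        using True by (intro nn_integral_cong) (simp add: indicator_def snoc_in_ordered_simplex mult_ac)
      also have "\<dots> = ennreal (y ^ l n * (- log_tan y) ^ a n) *
          (\<integral>\<^sup>+\<theta>. indicator (ordered_simplex n y) \<theta> * ennreal (?h n \<theta>) \<partial>PiM {..<n} (\<lambda>_. lborel))"
        by (rule nn_integral_cmult) measurable
      also have "\<dots> = ennreal (?f y)"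
        using Suc.IH[of y] True Suc.prems pos[of y]
        by (simp only: eq[symmetric]) (simp add: ennreal_mult')
      finally show ?thesis
        using True by simp
    next
      case False
      then show ?thesis
        by (auto simp: snoc_in_ordered_simplex)
    qed
  qed
  finally have 1: "(\<integral>\<^sup>+\<theta>. indicator (ordered_simplex (Suc n) \<sigma>) \<theta> * ennreal (?h (Suc n) \<theta>)
        \<partial>PiM {..<Suc n} (\<lambda>_. lborel)) = (\<integral>\<^sup>+y. indicator {0<..<\<sigma>} y * ennreal (?f y) \<partial>lborel)" .
  have anti: "antideriv ?f (\<lambda>x. (- 1) ^ (\<Sum>u<Suc n. a u) * iter_int l a (Suc n) x)"
    by (intro antideriv_cmult antideriv_iter_int)
  have "0 \<le> ?f x" if "0 < x" "x < \<sigma>" for x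
    unfolding eq[symmetric] using pos[OF that] Suc.IH[of x] that Suc.prems by auto
  moreover have "isCont ?f x" if "0 < x" "x < \<sigma>" for x
  proof -
    have "x < pi"
      using that Suc.prems by auto
    then show ?thesis
      using that isCont_iter_int[of x l a n] DERIV_isCont[OF log_tan_deriv[of x]]
      by (intro continuous_intros) auto
  qed
  ultimately show ?case
    unfolding 1 using antideriv_nn_integral[OF anti] Suc.prems pi_half_less_two pi_gt_zero by auto
qed

lemma Lt_eq_iter_int:
  assumes "0 < \<sigma>" "\<sigma> \<le> pi / 2"
  shows "Lt ks ls \<sigma> = (- 1) ^ length ks * iter_int ((!) ls) (log_exp ks ls) (length ks) \<sigma>"
proof -
  let ?n = "length ks" and ?l = "(!) ls" and ?a = "log_exp ks ls"
  let ?M = "PiM {..<?n} (\<lambda>_. lborel :: real measure)"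
  let ?h = "\<lambda>\<theta>. \<Prod>u<?n. \<theta> u ^ ?l u * (- log_tan (\<theta> u)) ^ ?a u"
  \<comment> \<open>The sign that turns the logarithms into their nonnegative negatives. It occurs
    again in the value of the integral, and the two cancel.\<close>
  let ?s = "(- 1 :: real) ^ (\<Sum>u<?n. ?a u)"
  have bd: "0 < \<theta> u" "\<theta> u < pi / 2" if "\<theta> \<in> ordered_simplex ?n \<sigma>" "u < ?n" for \<theta> u
    using that assms by (force simp: ordered_simplex_def)+
  have pos: "0 \<le> ?h \<theta>" if "\<theta> \<in> ordered_simplex ?n \<sigma>" for \<theta>
    using bd[OF that] log_tan_nonpos by (intro prod_nonneg) (auto simp: less_imp_le)
  have "(LINT \<theta>:ordered_simplex ?n \<sigma>|?M. (\<Prod>u<?n. \<theta> u ^ (ls ! u) * ln \<bar>tan (\<theta> u / 2)\<bar> ^ ?a u)) =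
      (LINT \<theta>|?M. ?s * (indicator (ordered_simplex ?n \<sigma>) \<theta> * ?h \<theta>))"
    unfolding set_lebesgue_integral_def
  proof (rule Bochner_Integration.integral_cong[OF refl])
    fix \<theta> :: "nat \<Rightarrow> real"
    show "indicat_real (ordered_simplex ?n \<sigma>) \<theta> *\<^sub>R (\<Prod>u<?n. \<theta> u ^ (ls ! u) * ln \<bar>tan (\<theta> u / 2)\<bar> ^ ?a u) =
        ?s * (indicator (ordered_simplex ?n \<sigma>) \<theta> * ?h \<theta>)"
    proof (cases "\<theta> \<in> ordered_simplex ?n \<sigma>")
      case True
      have "?s * ?h \<theta> = (\<Prod>u<?n. (- 1) ^ ?a u * (\<theta> u ^ ?l u * (- log_tan (\<theta> u)) ^ ?a u))"
        by (simp only: power_sum prod.distrib)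
      also have "\<dots> = (\<Prod>u<?n. \<theta> u ^ (ls ! u) * ln \<bar>tan (\<theta> u / 2)\<bar> ^ ?a u)"
      proof (rule prod.cong[OF refl])
        fix u assume "u \<in> {..<?n}"
        then have "0 < tan (\<theta> u / 2)"
          using bd[OF True, of u] by (intro tan_half_pos) auto
        then have "ln \<bar>tan (\<theta> u / 2)\<bar> = - 1 * (- log_tan (\<theta> u))"
          by (simp add: log_tan_def)
        then show "(- 1) ^ ?a u * (\<theta> u ^ ?l u * (- log_tan (\<theta> u)) ^ ?a u) =
            \<theta> u ^ (ls ! u) * ln \<bar>tan (\<theta> u / 2)\<bar> ^ ?a u"
          by (simp only: power_mult_distrib mult_ac)
      qed
      finally show ?thesis
        using True by simp
    qed simp
  qed
  also have "\<dots> = ?s * (LINT \<theta>|?M. indicator (ordered_simplex ?n \<sigma>) \<theta> * ?h \<theta>)"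
    by (rule integral_mult_right_zero)
  also have "(LINT \<theta>|?M. indicator (ordered_simplex ?n \<sigma>) \<theta> * ?h \<theta>) =
      enn2real (\<integral>\<^sup>+\<theta>. ennreal (indicator (ordered_simplex ?n \<sigma>) \<theta> * ?h \<theta>) \<partial>?M)"
    using pos by (intro integral_eq_nn_integral) (auto simp: indicator_def)
  also have "(\<integral>\<^sup>+\<theta>. ennreal (indicator (ordered_simplex ?n \<sigma>) \<theta> * ?h \<theta>) \<partial>?M) =
      (\<integral>\<^sup>+\<theta>. indicator (ordered_simplex ?n \<sigma>) \<theta> * ennreal (?h \<theta>) \<partial>?M)"
    by (intro nn_integral_cong) (auto simp: indicator_def)
  also have "enn2real \<dots> = ?s * iter_int ?l ?a ?n \<sigma>"
    using ordered_simplex_nn_integral[OF assms, of ?n ?l ?a] by simp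
  also have "?s * (?s * iter_int ?l ?a ?n \<sigma>) = iter_int ?l ?a ?n \<sigma>"
    by (simp flip: mult.assoc power_add mult_2)
  finally show ?thesis
    by (simp add: Lt_def)
qed

subsection \<open>Comparison of the spans\<close>

lemma span_subset_spanI: "(\<And>x. x \<in> S \<Longrightarrow> x \<in> rat_span T) \<Longrightarrow> rat_span S \<subseteq> rat_span T"
  by (intro rat_real.span_minimal rat_real.subspace_span subsetI)

lemma sign_in_span:
  assumes "x \<in> rat_span S"
  shows "(- 1) ^ n * x \<in> rat_span S"
proof -
  have "of_rat ((- 1) ^ n) * x \<in> rat_span S"
    using assms by (rule rat_real.span_scale)
  then show ?thesis
    by (simp add: of_rat_power of_rat_minus)
qed

lemma sign_in_span_iff: "(- 1) ^ n * x \<in> rat_span S \<longleftrightarrow> x \<in> rat_span S"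
  using sign_in_span[of x S n] sign_in_span[of "(- 1) ^ n * x" S n]
  by (auto simp flip: mult.assoc power_add mult_2)

text \<open>At \<open>pi / 2\<close> the logarithm is 0, so only the generators with
  \<open>b = 0\<close> survive.\<close>

lemma iter_int_in_span_A_real:
  "iter_int l a n (pi / 2) \<in> rat_span {A_real ks (pi / 2) | ks.
    is_index ks \<and> weight ks = (\<Sum>u<n. l u + a u + 1) \<and> length ks = (\<Sum>u<n. l u + 1)}"
    (is "_ \<in> rat_span ?T")
proof -
  have "s (pi / 2) \<in> rat_span ?T"
    if gen: "s \<in> log_A_gens (\<Sum>u<n. l u + a u + 1) (\<Sum>u<n. l u + 1)" for s
  proof -
    obtain b ks where s: "s = (\<lambda>x. log_tan x ^ b * A_real ks x)" "is_index ks"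
      "b + weight ks = (\<Sum>u<n. l u + a u + 1)" "length ks = (\<Sum>u<n. l u + 1)"
      using gen by (auto simp: log_A_gens_def)
    show ?thesis
    proof (cases "b = 0")
      case True
      then have "s (pi / 2) \<in> ?T"
        using s by auto
      then show ?thesis
        by (rule rat_real.span_base)
    next
      case False
      then have "s (pi / 2) = 0"
        using s by simp
      then show ?thesis
        by (simp only: rat_real.span_zero)
    qed
  qed
  then have "rat_span ((\<lambda>s. s (pi / 2)) ` log_A_gens (\<Sum>u<n. l u + a u + 1) (\<Sum>u<n. l u + 1)) \<subseteq> rat_span ?T"
    by (intro span_subset_spanI) blast
  with rat_comb_eval[OF iter_int_in_rat_comb, of "pi / 2" l a n] show ?thesis
    by auto
qed

lemma A_real_in_span_iter_int:
  assumes "is_index ks"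
  shows "A_real ks (pi / 2) \<in> rat_span {iter_int (\<lambda>_. 0) a (length ks) (pi / 2) | a.
    (\<Sum>u<length ks. a u + 1) = weight ks}" (is "_ \<in> rat_span ?T")
proof -
  have "s (pi / 2) \<in> rat_span ?T" if gen: "s \<in> log_iter_gens (weight ks) (length ks)" for s
  proof -
    obtain a b where s: "s = (\<lambda>x. log_tan x ^ b * iter_int (\<lambda>_. 0) a (length ks) x)"
      "b + (\<Sum>u<length ks. a u + 1) = weight ks"
      using gen by (auto simp: log_iter_gens_def)
    show ?thesis
    proof (cases "b = 0")
      case True
      then have "s (pi / 2) \<in> ?T"
        using s by auto
      then show ?thesis
        by (rule rat_real.span_base)
    next
      case False
      then have "s (pi / 2) = 0"
        using s by simp
      then show ?thesis
        by (simp only: rat_real.span_zero)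
    qed
  qed
  then have "rat_span ((\<lambda>s. s (pi / 2)) ` log_iter_gens (weight ks) (length ks)) \<subseteq> rat_span ?T"
    by (intro span_subset_spanI) blast
  with rat_comb_eval[OF A_real_in_rat_comb_log_iter[OF assms], of "pi / 2"] show ?thesis
    by auto
qed

text \<open>The truth value \<open>p\<close> treats the even and the odd case at once.\<close>

lemma span_Lt_eq_span_A_real:
  "rat_span {Lt ks ls (pi / 2) | ks ls. index_pair ks ls \<and> weight ks = k \<and> even (log_weight ks ls) = p} =
    rat_span {A_real ks (pi / 2) | ks. is_index ks \<and> weight ks = k \<and> even (weight ks + length ks) = p}"
  (is "rat_span ?L = rat_span ?A")
proof
  show "rat_span ?L \<subseteq> rat_span ?A"
  proof (rule span_subset_spanI)
    fix x assume "x \<in> ?L"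
    then obtain ks ls where *: "x = Lt ks ls (pi / 2)" "index_pair ks ls" "weight ks = k"
      "even (log_weight ks ls) = p"
      by blast
    let ?n = "length ks" and ?a = "log_exp ks ls"
    have "ks ! u = ls ! u + ?a u + 1" if "u < ?n" for u
    proof -
      have "1 \<le> ks ! u" "ls ! u \<le> ks ! u - 1"
        using *(2) that by (simp_all add: index_pair_def is_index_def)
      then show ?thesis
        by (simp add: log_exp_def)
    qed
    then have w: "(\<Sum>u<?n. ls ! u + ?a u + 1) = k"
      using *(3) by (simp add: weight_def sum_list_sum_nth atLeast0LessThan)
    \<comment> \<open>The sum on the right is the depth of the A-functions that arise; hence their
      weight plus depth has the parity of \<open>log_weight\<close>.\<close>
    have "k = log_weight ks ls + (\<Sum>u<?n. ls ! u + 1)"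
      unfolding w[symmetric] log_weight_def sum.distrib by simp
    then have p: "even (k + (\<Sum>u<?n. ls ! u + 1)) = p"
      using *(4) by (simp, blast)
    have "{A_real js (pi / 2) | js. is_index js \<and> weight js = (\<Sum>u<?n. ls ! u + ?a u + 1) \<and>
        length js = (\<Sum>u<?n. ls ! u + 1)} \<subseteq> ?A"
      unfolding w using p by auto
    then have "iter_int ((!) ls) ?a ?n (pi / 2) \<in> rat_span ?A"
      using iter_int_in_span_A_real[of "(!) ls" ?a ?n] rat_real.span_mono by blast
    then show "x \<in> rat_span ?A"
      by (simp add: *(1) Lt_eq_iter_int sign_in_span)
  qed
next
  show "rat_span ?A \<subseteq> rat_span ?L"
  proof (rule span_subset_spanI)
    fix x assume "x \<in> ?A"
    then obtain ks where *: "x = A_real ks (pi / 2)" "is_index ks" "weight ks = k"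
      "even (weight ks + length ks) = p"
      by blast
    let ?d = "length ks"
    have "iter_int (\<lambda>_. 0) a ?d (pi / 2) \<in> rat_span ?L" if a: "(\<Sum>u<?d. a u + 1) = weight ks" for a
    proof -
      \<comment> \<open>The index pair realising the exponents \<open>a\<close> with no powers of
        the variables: here \<open>log_exp\<close> is \<open>a\<close>, and its total is the weight
        minus the depth.\<close>
      let ?ks = "map (\<lambda>u. a u + 1) [0..<?d]" and ?ls = "replicate ?d (0 :: nat)"
      have "iter_int (\<lambda>_. 0) a ?d = iter_int ((!) ?ls) (log_exp ?ks ?ls) ?d"
        by (rule iter_int_cong) (simp_all add: log_exp_def)
      then have eq: "Lt ?ks ?ls (pi / 2) = (- 1) ^ ?d * iter_int (\<lambda>_. 0) a ?d (pi / 2)"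
        by (simp add: Lt_eq_iter_int)
      have pair: "index_pair ?ks ?ls"
        by (auto simp: index_pair_def is_index_def)
      have wt: "weight ?ks = k"
        using a *(3) by (simp add: weight_def interv_sum_list_conv_sum_set_nat atLeast0LessThan)
      have lw: "log_weight ?ks ?ls = (\<Sum>u<?d. a u)"
        by (simp add: log_weight_def log_exp_def)
      have ev: "even (\<Sum>u<?d. a u) = p"
        using *(4) unfolding a[symmetric] sum.distrib by auto
      have "Lt ?ks ?ls (pi / 2) \<in> ?L"
        using pair wt ev unfolding lw[symmetric] by blast
      from rat_real.span_base[OF this] show ?thesis
        unfolding eq by (rule sign_in_span_iff[THEN iffD1])
    qed
    then have "rat_span {iter_int (\<lambda>_. 0) a ?d (pi / 2) | a. (\<Sum>u<?d. a u + 1) = weight ks} \<subseteq> rat_span ?L"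
      by (intro span_subset_spanI) blast
    then show "x \<in> rat_span ?L"
      using A_real_in_span_iter_int[OF *(2)] *(1) by blast
  qed
qed

lemma i_power: "\<i> ^ n = (if even n then (- 1) ^ (n div 2) else \<i> * (- 1) ^ (n div 2))"
proof (cases "even n")
  case True
  then obtain m where "n = 2 * m" ..
  then show ?thesis by (simp add: power_mult)
next
  case False
  then obtain m where "n = 2 * m + 1" ..
  then show ?thesis by (simp add: power_mult)
qed

lemma Ae_Ao_eq:
  assumes "is_index ks"
  shows "Ae ks (pi / 2) =
      (if even (weight ks + length ks) then (- 1) ^ (length ks div 2) * A_real ks (pi / 2) else 0)"
    and "Ao ks (pi / 2) =
      (if odd (weight ks + length ks) then (- 1) ^ (length ks div 2) * A_real ks (pi / 2) else 0)"
proof -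
  have sign: "(- 1 :: complex) ^ m = of_real ((- 1) ^ m)" for m
    by simp
  have "multA ks (cis (pi / 2)) = (if even (length ks) then of_real ((- 1) ^ (length ks div 2) * A_real ks (pi / 2))
      else \<i> * of_real ((- 1) ^ (length ks div 2) * A_real ks (pi / 2)))"
    by (simp add: multA_i[OF assms] i_power[of "length ks"])
  then show "Ae ks (pi / 2) =
      (if even (weight ks + length ks) then (- 1) ^ (length ks div 2) * A_real ks (pi / 2) else 0)"
    and "Ao ks (pi / 2) =
      (if odd (weight ks + length ks) then (- 1) ^ (length ks div 2) * A_real ks (pi / 2) else 0)"
    by (simp_all only: Ae_def Ao_def even_add) (simp_all del: of_real_mult of_real_power)
qed

text \<open>Zero generators and signs do not change a span. This passes from \<open>Ae\<close> and
  \<open>Ao\<close> to \<open>A_real\<close> on the indices of the right parity.\<close>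

lemma span_signed_eq:
  assumes "\<And>ks. P ks \<Longrightarrow> f ks = (if Q ks then (- 1) ^ n ks * g ks else 0)"
  shows "rat_span {f ks | ks. P ks} = rat_span {g ks | ks. P ks \<and> Q ks}" (is "rat_span ?F = rat_span ?G")
proof
  show "rat_span ?F \<subseteq> rat_span ?G"
  proof (rule span_subset_spanI)
    fix x assume "x \<in> ?F"
    then obtain ks where ks: "x = f ks" "P ks" by auto
    show "x \<in> rat_span ?G"
    proof (cases "Q ks")
      case True
      with ks(2) have "g ks \<in> rat_span ?G"
        by (intro rat_real.span_base) auto
      then show ?thesis
        using ks assms True by (simp add: sign_in_span)
    next
      case False
      then show ?thesis
        using ks assms by (simp add: rat_real.span_zero)
    qed
  qed
next
  show "rat_span ?G \<subseteq> rat_span ?F"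
  proof (rule span_subset_spanI)
    fix x assume "x \<in> ?G"
    then obtain ks where ks: "x = g ks" "P ks" "Q ks" by auto
    then have "f ks \<in> rat_span ?F"
      by (intro rat_real.span_base) auto
    then show "x \<in> rat_span ?F"
      using ks assms[OF ks(2)] by (simp add: sign_in_span_iff)
  qed
qed

theorem theorem1:
  fixes k :: nat
  shows "L_e k = A_e k \<and> L_o k = A_o k"
proof
  have "A_e k = rat_span {A_real ks (pi / 2) | ks. (is_index ks \<and> weight ks = k) \<and> even (weight ks + length ks)}"
    unfolding A_e_def by (rule span_signed_eq) (use Ae_Ao_eq(1) in blast)
  then show "L_e k = A_e k"
    using span_Lt_eq_span_A_real[of k True] by (simp add: L_e_def conj_assoc)
  have "A_o k = rat_span {A_real ks (pi / 2) | ks. (is_index ks \<and> weight ks = k) \<and> odd (weight ks + length ks)}"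
    unfolding A_o_def by (rule span_signed_eq) (use Ae_Ao_eq(2) in blast)
  then show "L_o k = A_o k"
    using span_Lt_eq_span_A_real[of k False] by (simp add: L_o_def conj_assoc)
qed

end
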